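(* For $n\ge 0$ let $p(n)=t$ if $n$ is even and $p(n)=1$ if $n$ is odd, and define $$\mathbf F(n)=(b+y)^n+\sum_{i=0}^n\binom{n}{i}p(i)\,w^{n-i}z^i\in\mathbb{Z}[b,w,y,z,t],\qquad S(u)=\sum_{k\ge1}\mathbf F(k)\frac{\xi_k u^k}{k!}.$$ Apply the linear functional $\langle\cdot\rangle_{bw}$ coefficientwise in $u$ to $\exp S(u)$. Then $$\langle \exp S(u)\rangle_{bw}=\sum_{\mathbf n}u^{|\mathbf n|}\sum_{G\in G(\mathbf n)}\frac{W_G(t)\prod_k\xi_k^{n_k}}{|\operatorname{Aut}G|},$$ and $$\mathscr B(u):=\sum_{\mathbf n}u^{|\mathbf n|}\sum_{G\in G_c(\mathbf n)}\frac{W_G(t)\prod_k\xi_k^{n_k}}{|\operatorname{Aut}G|}=\log\langle\exp S(u)\rangle_{bw}.$$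
   Context: Graphs are finite and may have loops and parallel edges. A coloring is a map $c\colon V(G)\to\{0,1\}$ ($0$ white, $1$ black). A vertex $v$ is even-white if $c(v)=0$ and the total number of edges joining $v$ to black vertices (counted with multiplicity; loops at $v$ are not counted) is even. $W_G(t)=\sum_c t^{\#\{\text{even-white vertices}\}}$, and $W_\emptyset=1$. The degree of a vertex counts a loop twice. A profile is a sequence $\mathbf n=(n_1,n_2,\dots)$ of nonnegative integers, finitely many nonzero, with $|\mathbf n|=\sum_k k n_k$; $G(\mathbf n)$ is the finite set of isomorphism classes of graphs with exactly $n_k$ vertices of degree $k$ for each $k$ (for $\mathbf n=0$ this is the empty graph), and $G_c(\mathbf n)$ its subset of connected graphs. $\operatorname{Aut}G$ is the full automorphism group, including permutations of vertices, permutations of parallel edges, and flips and permutations of loops. $\xi_1,\xi_2,\dots,u$ are indeterminates. The $\mathbb{Q}[t,\xi_1,\xi_2,\dots]$-linear functional $\langle\cdot\rangle_{bw}$ on polynomials in $b,w,y,z$ is defined on monomials by $\langle b^nw^my^kz^l\rangle_{bw}=\langle b^n\rangle_{bw}\langle w^m\rangle_{bw}\langle y^kz^l\rangle_{bw}$, where $\langle b^n\rangle_{bw}=\langle w^n\rangle_{bw}=n!/(2^{n/2}(n/2)!)$ if $n$ is even and $0$ if $n$ is odd, and $\langle y^kz^l\rangle_{bw}=k!$ if $k=l$ and $0$ otherwise. *)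

theory Defs
  imports
    "HOL-Computational_Algebra.Formal_Power_Series"
    "HOL-Library.Poly_Mapping"
    "HOL-Library.Disjoint_Sets"
    "HOL-Library.FuncSet"
    "HOL-Combinatorics.Permutations"
begin

section \<open>Multigraphs with loops\<close>

text \<open>
  An edge is the two-element set of its ends (half-edges), no end is shared by two edges, and
  \<open>att\<close> attaches every end to a vertex.  Parallel edges are distinct edges whose ends are
  attached to the same two vertices; a loop is an edge with both ends attached to one vertex.
  Working with ends rather than with an edge/endpoint incidence is what makes the flip of a loop
  a nontrivial automorphism.  The function \<open>att\<close> is irrelevant outside the set of ends.
\<close>

record ('v, 'h) mgraph =
  verts :: "'v set"
  edges :: "'h set set"
  att :: "'h \<Rightarrow> 'v"

definition ends :: "('v, 'h) mgraph \<Rightarrow> 'h set" where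
  "ends G = \<Union>(edges G)"

definition is_mgraph :: "('v, 'h) mgraph \<Rightarrow> bool" where
  "is_mgraph G \<longleftrightarrow> finite (verts G) \<and> finite (edges G) \<and> (\<forall>e\<in>edges G. card e = 2) \<and>
     disjoint (edges G) \<and> att G ` ends G \<subseteq> verts G"

text \<open>A loop contributes two ends, hence 2 to the degree.\<close>

definition vdegree :: "('v, 'h) mgraph \<Rightarrow> 'v \<Rightarrow> nat" where
  "vdegree G v = card {h \<in> ends G. att G h = v}"

definition is_iso ::
  "('v \<Rightarrow> 'w) \<Rightarrow> ('h \<Rightarrow> 'k) \<Rightarrow> ('v, 'h) mgraph \<Rightarrow> ('w, 'k) mgraph \<Rightarrow> bool" where
  "is_iso \<phi> \<psi> G K \<longleftrightarrow>
     bij_betw \<phi> (verts G) (verts K) \<and> bij_betw \<psi> (ends G) (ends K) \<and>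
     (\<lambda>e. \<psi> ` e) ` edges G = edges K \<and>
     (\<forall>h\<in>ends G. att K (\<psi> h) = \<phi> (att G h))"

text \<open>
  \<open>permutes\<close> makes both components the identity outside the graph, so that each automorphism is
  counted once.
\<close>

definition Aut :: "('v, 'h) mgraph \<Rightarrow> (('v \<Rightarrow> 'v) \<times> ('h \<Rightarrow> 'h)) set" where
  "Aut G = {(\<phi>, \<psi>). \<phi> permutes verts G \<and> \<psi> permutes ends G \<and> is_iso \<phi> \<psi> G G}"

definition adjacent :: "('v, 'h) mgraph \<Rightarrow> ('v \<times> 'v) set" where
  "adjacent G = {(u, v). \<exists>e\<in>edges G. att G ` e = {u, v}}"

text \<open>The empty graph is not connected.\<close>

definition connected_mgraph :: "('v, 'h) mgraph \<Rightarrow> bool" where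
  "connected_mgraph G \<longleftrightarrow>
     verts G \<noteq> {} \<and> (\<forall>u\<in>verts G. \<forall>v\<in>verts G. (u, v) \<in> (adjacent G)\<^sup>*)"


section \<open>The even-white polynomial\<close>

definition even_white :: "('v, 'h) mgraph \<Rightarrow> ('v \<Rightarrow> nat) \<Rightarrow> 'v \<Rightarrow> bool" where
  "even_white G c v \<longleftrightarrow> c v = 0 \<and>
     even (card {e \<in> edges G. \<exists>u\<in>verts G. u \<noteq> v \<and> c u = 1 \<and> att G ` e = {v, u}})"

definition W_poly :: "('v, 'h) mgraph \<Rightarrow> 'a \<Rightarrow> 'a::comm_semiring_1" where
  "W_poly G t = (\<Sum>c \<in> verts G \<rightarrow>\<^sub>E {0, 1}. t ^ card {v \<in> verts G. even_white G c v})"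


section \<open>Profiles and isomorphism classes\<close>

text \<open>
  A profile \<open>(n\<^sub>1, n\<^sub>2, \<dots>)\<close> is a finitely supported function on the natural numbers whose
  entry at 0 is 0: graphs with a given profile have no vertices of degree 0.
\<close>

type_synonym profile = "nat \<Rightarrow>\<^sub>0 nat"

definition is_profile :: "profile \<Rightarrow> bool" where
  "is_profile n \<longleftrightarrow> Poly_Mapping.lookup n 0 = 0"

definition profile_weight :: "profile \<Rightarrow> nat" where
  "profile_weight n = (\<Sum>k\<in>Poly_Mapping.keys n. k * Poly_Mapping.lookup n k)"

definition has_profile :: "('v, 'h) mgraph \<Rightarrow> profile \<Rightarrow> bool" where
  "has_profile G n \<longleftrightarrow> (\<forall>k. card {v \<in> verts G. vdegree G v = k} = Poly_Mapping.lookup n k)"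

text \<open>Every finite graph is isomorphic to one whose vertices and ends are natural numbers.\<close>

type_synonym ngraph = "(nat, nat) mgraph"

definition iso_rel :: "(ngraph \<times> ngraph) set" where
  "iso_rel = {(G, K). is_mgraph G \<and> is_mgraph K \<and> (\<exists>\<phi> \<psi>. is_iso \<phi> \<psi> G K)}"

definition graph_classes :: "profile \<Rightarrow> ngraph set set" where
  "graph_classes n = {G. is_mgraph G \<and> has_profile G n} // iso_rel"

definition connected_graph_classes :: "profile \<Rightarrow> ngraph set set" where
  "connected_graph_classes n =
     {G. is_mgraph G \<and> has_profile G n \<and> connected_mgraph G} // iso_rel"

definition representative :: "ngraph set \<Rightarrow> ngraph" where
  "representative C = (SOME G. G \<in> C)"


section \<open>Polynomial rings\<close>

type_synonym ('x, 'a) mpoly = "('x \<Rightarrow>\<^sub>0 nat) \<Rightarrow>\<^sub>0 'a"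

definition mvar :: "'x \<Rightarrow> ('x, 'a::comm_semiring_1) mpoly" where
  "mvar x = Poly_Mapping.single (Poly_Mapping.single x 1) 1"

definition mconst :: "'a::comm_semiring_1 \<Rightarrow> ('x, 'a) mpoly" where
  "mconst a = Poly_Mapping.single 0 a"

text \<open>
  The coefficient ring \<open>\<rat>[t, \<xi>\<^sub>1, \<xi>\<^sub>2, \<dots>]\<close> and the polynomials in \<open>b, w, y, z\<close> over it.
  The indeterminate \<open>Var_xi 0\<close> is never used.
\<close>

datatype coeff_var = Var_t | Var_xi nat

datatype bwyz_var = Var_b | Var_w | Var_y | Var_z

type_synonym coeff_ring = "(coeff_var, rat) mpoly"

type_synonym bwyz_ring = "(bwyz_var, coeff_ring) mpoly"

definition t_ind :: coeff_ring where "t_ind = mvar Var_t"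

definition xi :: "nat \<Rightarrow> coeff_ring" where "xi k = mvar (Var_xi k)"


section \<open>Power series in \<open>u\<close>\<close>

definition fps_map :: "('a \<Rightarrow> 'b) \<Rightarrow> 'a fps \<Rightarrow> 'b fps" where
  "fps_map f A = Abs_fps (\<lambda>n. f (fps_nth A n))"

text \<open>
  \<open>fps_exp 1\<close> is \<open>exp x\<close> and \<open>fps_ln 1\<close> is \<open>log (1 + x)\<close>.  They live over a field of
  characteristic 0, whence the embedding \<open>mconst\<close> of the rational numbers.  As usual, the
  substitution in \<open>exp_series A\<close> requires \<open>A\<close> to have constant term 0 and that in
  \<open>log_series A\<close> requires \<open>A\<close> to have constant term 1.
\<close>

definition exp_series :: "bwyz_ring fps \<Rightarrow> bwyz_ring fps" where
  "exp_series A = fps_compose (fps_map (\<lambda>q. mconst (mconst q)) (fps_exp 1)) A"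

definition log_series :: "coeff_ring fps \<Rightarrow> coeff_ring fps" where
  "log_series A = fps_compose (fps_map mconst (fps_ln 1)) (A - 1)"


section \<open>The functional and the two sides\<close>

definition gauss_moment :: "nat \<Rightarrow> rat" where
  "gauss_moment n = (if even n then fact n / (2 ^ (n div 2) * fact (n div 2)) else 0)"

definition bw_monomial :: "(bwyz_var \<Rightarrow>\<^sub>0 nat) \<Rightarrow> rat" where
  "bw_monomial m =
     gauss_moment (Poly_Mapping.lookup m Var_b) * gauss_moment (Poly_Mapping.lookup m Var_w) *
     (if Poly_Mapping.lookup m Var_y = Poly_Mapping.lookup m Var_z
      then fact (Poly_Mapping.lookup m Var_y) else 0)"

definition bw :: "bwyz_ring \<Rightarrow> coeff_ring" where
  "bw P = (\<Sum>m\<in>Poly_Mapping.keys P. Poly_Mapping.lookup P m * mconst (bw_monomial m))"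

definition p_par :: "nat \<Rightarrow> coeff_ring" where
  "p_par n = (if even n then t_ind else 1)"

definition F_poly :: "nat \<Rightarrow> bwyz_ring" where
  "F_poly n = (mvar Var_b + mvar Var_y) ^ n +
     (\<Sum>i=0..n. of_nat (n choose i) * mconst (p_par i) * mvar Var_w ^ (n - i) * mvar Var_z ^ i)"

definition S_series :: "bwyz_ring fps" where
  "S_series = Abs_fps (\<lambda>k. if k = 0 then 0 else F_poly k * mconst (xi k * mconst (1 / fact k)))"

definition graph_term :: "profile \<Rightarrow> ngraph \<Rightarrow> coeff_ring" where
  "graph_term n G = W_poly G t_ind * (\<Prod>k\<in>Poly_Mapping.keys n. xi k ^ Poly_Mapping.lookup n k) *
     mconst (1 / of_nat (card (Aut G)))"

text \<open>
  \<open>graph_series \<G>\<close> is the sum over all profiles \<open>n\<close> of \<open>u\<close> to the power \<open>profile_weight n\<close> times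
  the sum of \<open>graph_term n\<close> over \<open>\<G> n\<close>, collected by powers of \<open>u\<close>: only finitely many
  profiles have a given weight.
\<close>

definition graph_series :: "(profile \<Rightarrow> ngraph set set) \<Rightarrow> coeff_ring fps" where
  "graph_series \<G> = Abs_fps (\<lambda>m. \<Sum>n | is_profile n \<and> profile_weight n = m.
     \<Sum>C\<in>\<G> n. graph_term n (representative C))"

end

theory Submission
  imports Defs
begin

text \<open>
  Profiles exclude isolated vertices, so a graph is a pair \<open>(P, M)\<close> of a partition \<open>P\<close> of its ends
  (the vertices) and a perfect matching \<open>M\<close> of its ends (the edges).  By orbit counting, the sum of
  \<open>1 / card (Aut G)\<close> over isomorphism classes with \<open>m\<close> ends is \<open>1 / m!\<close> times the sum over all such
  pairs on \<open>{..<m}\<close>.  By the exponential formula, \<open>exp S(u)\<close> is the exponential generating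
  function of the partitions \<open>P\<close>, weighted by the product of \<open>F(card B) \<xi>\<close> over the blocks \<open>B\<close>.
  Expanding each factor chooses a color for the block and, for each end, whether its edge is to be
  bichromatic (\<open>y\<close>, \<open>z\<close>) or monochromatic (\<open>b\<close>, \<open>w\<close>); the functional then counts the
  matchings compatible with these choices (Wick's formula), and each matching is compatible with
  exactly one choice for every coloring.  Finally, splitting off the connected component of one end
  gives \<open>A' = C' A\<close> for the series of all and of connected graphs, whence \<open>C = log A\<close>.
\<close>

text \<open>The functional suits colorings because its values count matchings:
  \<open>gauss_moment n\<close> is the number of perfect matchings of n points, and k! the number of
  bijections between k ends marked y and k ends marked z. A white block with i ends declared
  bichromatic carries p(i), which is t exactly when i is even. A loop joins two ends of one block,
  so it is never bichromatic, in agreement with the rule that loops do not count for even-whiteness.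

  Forgetting vertex labels loses no automorphisms: without isolated vertices an automorphism is
  determined by its action on the ends, so permutations of the m ends alone account for Aut G. The
  price is that vertices become sets of ends, while the isomorphism classes consist of graphs on
  natural numbers, so graphs over two vertex types have to be compared.

  exp and log are identified through differential equations rather than coefficients. Neither
  polynomial ring is a field, but positive integers are invertible in both, which is enough to
  recover a series from its derivative and its constant term.\<close>

unbundle fps_syntax

section \<open>Exponential generating functions over a ring containing the rationals\<close>

text \<open>Serves both \<open>coeff_ring\<close> and \<open>bwyz_ring\<close>, with
  \<open>\<kappa>\<close> the embedding of rational constants.\<close>

locale rat_algebra =
  fixes \<kappa> :: "rat \<Rightarrow> 'a::comm_ring_1"
  assumes hom_add: "\<kappa> (x + y) = \<kappa> x + \<kappa> y"
    and hom_mult: "\<kappa> (x * y) = \<kappa> x * \<kappa> y"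
    and hom_one: "\<kappa> 1 = 1"
begin

lemma hom_zero: "\<kappa> 0 = 0"
  using hom_add[of 0 0] by simp

lemma hom_uminus: "\<kappa> (- x) = - \<kappa> x"
  using hom_add[of x "- x"] by (simp add: hom_zero eq_neg_iff_add_eq_0 add.commute)

lemma hom_of_nat: "\<kappa> (of_nat n) = of_nat n"
  by (induction n) (simp_all add: hom_zero hom_one hom_add)

text \<open>The image under \<open>\<kappa>\<close> of the rational 1 / (n + 1) is an inverse of n +
  1 in the ring.\<close>

lemma of_nat_cancel:
  fixes x y :: 'a
  assumes "of_nat (Suc n) * x = of_nat (Suc n) * y"
  shows "x = y"
proof -
  have inv: "\<kappa> (1 / of_nat (Suc n)) * of_nat (Suc n) = 1"
    by (simp add: hom_one flip: hom_of_nat hom_mult del: of_nat_Suc)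
  have "x = \<kappa> (1 / of_nat (Suc n)) * (of_nat (Suc n) * x)"
    by (metis inv mult.assoc mult.left_neutral)
  also have "\<dots> = y"
    by (metis assms inv mult.assoc mult.left_neutral)
  finally show ?thesis .
qed

lemma of_nat_fact_Suc: "of_nat (Suc n) * \<kappa> (1 / fact (Suc n)) = \<kappa> (1 / fact n)"
proof -
  have "of_nat (Suc n) * (1 / fact (Suc n)) = (1 / fact n :: rat)"
    by (simp del: of_nat_Suc)
  then show ?thesis by (metis hom_mult hom_of_nat)
qed

section \<open>Differential equations, and substitution into exp and log\<close>

lemma fps_eq_if_deriv_eq:
  fixes X Y :: "'a fps"
  assumes "fps_deriv X = fps_deriv Y" and "X $ 0 = Y $ 0"
  shows "X = Y"
proof (rule fps_ext)
  fix n show "X $ n = Y $ n"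
  proof (cases n)
    case (Suc k)
    have "of_nat (Suc k) * X $ Suc k = of_nat (Suc k) * Y $ Suc k"
      using arg_cong[OF assms(1), of "\<lambda>Z. Z $ k"] by simp
    then show ?thesis using of_nat_cancel Suc by blast
  qed (use assms in simp)
qed

text \<open>Coefficient k of the equation expresses (k + 1) times coefficient k + 1 through
  coefficients up to k, so the constant term determines the solution.\<close>

lemma linear_ode_unique:
  fixes X Y S :: "'a fps"
  assumes X: "fps_deriv X = S * X" and Y: "fps_deriv Y = S * Y" and "X $ 0 = Y $ 0"
  shows "X = Y"
proof (rule fps_ext)
  fix n show "X $ n = Y $ n"
  proof (induction n rule: less_induct)
    case (less n)
    show ?case
    proof (cases n)
      case (Suc k)
      have "of_nat (Suc k) * X $ Suc k = (S * X) $ k"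
        using arg_cong[OF X, of "\<lambda>Z. Z $ k"] by simp
      also have "\<dots> = (S * Y) $ k"
        unfolding fps_mult_nth by (intro sum.cong refl arg_cong2[of _ _ _ _ "(*)"]) (use less Suc in auto)
      also have "\<dots> = of_nat (Suc k) * Y $ Suc k"
        using arg_cong[OF Y, of "\<lambda>Z. Z $ k"] by simp
      finally show ?thesis using of_nat_cancel Suc by blast
    qed (use assms in simp)
  qed
qed

text \<open>
  The library has the chain rule only over integral domains, and integrality of
  \<open>('x, 'a) mpoly\<close> is available only for ordered exponents.
\<close>

lemma fps_deriv_compose:
  fixes F S :: "'a fps"
  assumes S: "S $ 0 = 0"
  shows "fps_deriv (F oo S) = (fps_deriv F oo S) * fps_deriv S"
proof (rule fps_ext)
  fix n
  have pow0: "S ^ j $ i = 0" if "i < j" for i j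
    using startsby_zero_power_prefix[OF S] that by blast
  have "fps_deriv (F oo S) $ n = (\<Sum>i=0..Suc n. F $ i * (of_nat (Suc n) * (S ^ i) $ Suc n))"
    by (simp add: fps_compose_nth sum_distrib_left mult.left_commute del: sum.cl_ivl_Suc of_nat_Suc)
  also have "\<dots> = (\<Sum>i=0..Suc n. F $ i * fps_deriv (S ^ i) $ n)"
    by (simp del: sum.cl_ivl_Suc)
  also have "\<dots> = (\<Sum>i=0..n. F $ Suc i * fps_deriv (S ^ Suc i) $ n)"
    by (subst sum.atLeast0_atMost_Suc_shift) (simp add: o_def del: power_Suc)
  also have "\<dots> = (\<Sum>i=0..n. (fps_deriv F) $ i * (S ^ i * fps_deriv S) $ n)"
  proof (intro sum.cong refl)
    fix i
    have "fps_deriv (S ^ Suc i) $ n = of_nat (Suc i) * (S ^ i * fps_deriv S) $ n"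
      unfolding fps_deriv_power by (simp add: mult.assoc mult.commute[of "fps_deriv S"] del: of_nat_Suc power_Suc)
    then show "F $ Suc i * fps_deriv (S ^ Suc i) $ n = (fps_deriv F) $ i * (S ^ i * fps_deriv S) $ n"
      by (simp add: mult_ac)
  qed
  also have "\<dots> = (\<Sum>i=0..n. \<Sum>j=0..n. (fps_deriv F) $ i * ((S ^ i) $ j * (fps_deriv S) $ (n - j)))"
    by (simp add: fps_mult_nth sum_distrib_left)
  also have "\<dots> = (\<Sum>j=0..n. \<Sum>i=0..n. (fps_deriv F) $ i * ((S ^ i) $ j * (fps_deriv S) $ (n - j)))"
    by (rule sum.swap)
  \<comment> \<open>\<open>S ^ i\<close> has no terms below degree \<open>i\<close>, so the inner
    sum may stop at \<open>j\<close>, as it does in the coefficient of a composition.\<close>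
  also have "\<dots> = (\<Sum>j=0..n. \<Sum>i=0..j. (fps_deriv F) $ i * ((S ^ i) $ j * (fps_deriv S) $ (n - j)))"
    by (intro sum.cong refl sum.mono_neutral_right) (auto simp: pow0)
  also have "\<dots> = ((fps_deriv F oo S) * fps_deriv S) $ n"
    by (simp add: fps_mult_nth fps_compose_nth sum_distrib_right mult.assoc)
  finally show "fps_deriv (F oo S) $ n = ((fps_deriv F oo S) * fps_deriv S) $ n" .
qed

text \<open>By the chain rule the composite solves E' = S' E, so to identify it with a series it
  suffices that this series solves the same equation.\<close>

lemma fps_exp_compose_unique:
  fixes S E :: "'a fps"
  assumes "S $ 0 = 0" and "fps_deriv E = fps_deriv S * E" and "E $ 0 = 1"
  shows "fps_map \<kappa> (fps_exp 1) oo S = E"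
proof (rule linear_ode_unique)
  have "fps_deriv (fps_map \<kappa> (fps_exp 1)) = fps_map \<kappa> (fps_exp 1)"
  proof (rule fps_ext)
    fix n
    show "fps_deriv (fps_map \<kappa> (fps_exp 1)) $ n = fps_map \<kappa> (fps_exp 1) $ n"
      using of_nat_fact_Suc[of n] by (simp add: fps_map_def del: fact_Suc of_nat_Suc)
  qed
  then show "fps_deriv (fps_map \<kappa> (fps_exp 1) oo S) = fps_deriv S * (fps_map \<kappa> (fps_exp 1) oo S)"
    by (simp add: fps_deriv_compose assms mult.commute)
qed (use assms in \<open>simp_all add: fps_map_def hom_one\<close>)

text \<open>Up to degree n the composite agrees with the finite geometric sum of the powers of -X,
  which telescopes against 1 + X up to a power of order n + 1.\<close>

lemma geometric_compose:
  fixes X :: "'a fps"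
  assumes X: "X $ 0 = 0"
  shows "(Abs_fps (\<lambda>n. (-1) ^ n) oo X) * (1 + X) = 1"
proof (rule fps_ext)
  fix n
  have pow0: "X ^ j $ i = 0" if "i < j" for i j
    using startsby_zero_power_prefix[OF X] that by blast
  let ?G = "Abs_fps (\<lambda>n. (-1) ^ n) :: 'a fps"
  let ?P = "\<Sum>i\<le>n. (- X) ^ i"
  have coeff: "(?G oo X) $ j = ?P $ j" if "j \<le> n" for j
  proof -
    have "(?G oo X) $ j = (\<Sum>i=0..j. (-1) ^ i * (X ^ i) $ j)"
      by (simp add: fps_compose_nth)
    also have "\<dots> = (\<Sum>i\<le>n. (-1) ^ i * (X ^ i) $ j)"
      by (rule sum.mono_neutral_left) (use that pow0 in auto)
    also have "\<dots> = ?P $ j"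
      unfolding fps_sum_nth
    proof (rule sum.cong)
      show "(-1) ^ i * (X ^ i) $ j = ((- X) ^ i) $ j" for i
        by (cases "even i") simp_all
    qed simp
    finally show ?thesis .
  qed
  have "((?G oo X) * (1 + X)) $ n = (?P * (1 + X)) $ n"
    unfolding fps_mult_nth by (intro sum.cong refl) (use coeff in auto)
  also have "?P * (1 + X) = 1 - (- X) ^ Suc n"
    using one_diff_power_eq[of "- X" "Suc n"] by (simp add: lessThan_Suc_atMost mult.commute)
  also have "\<dots> $ n = (1 :: 'a fps) $ n"
    using pow0[of n "Suc n"] startsby_zero_power_prefix[of "- X" "Suc n"] X by simp
  finally show "((?G oo X) * (1 + X)) $ n = (1 :: 'a fps) $ n" .
qed

text \<open>The logarithmic derivative A'/A = C', with the quotient realized by the geometric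
  series, the derivative of log(1 + x), at A - 1.\<close>

lemma fps_ln_compose_unique:
  fixes A C :: "'a fps"
  assumes A0: "A $ 0 = 1" and C0: "C $ 0 = 0" and deriv: "fps_deriv A = fps_deriv C * A"
  shows "fps_map \<kappa> (fps_ln 1) oo (A - 1) = C"
proof (rule fps_eq_if_deriv_eq)
  let ?G = "Abs_fps (\<lambda>n. (-1) ^ n) :: 'a fps"
  have "fps_deriv (fps_map \<kappa> (fps_ln 1)) = ?G"
  proof (rule fps_ext)
    fix n
    have pm: "\<kappa> ((-1) ^ n) = (-1) ^ n"
      by (induction n) (simp_all add: hom_one hom_uminus)
    have "of_nat (Suc n) * \<kappa> ((-1) ^ n / of_nat (Suc n)) = (-1) ^ n"
      by (simp add: pm flip: hom_mult hom_of_nat del: of_nat_Suc)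
    then show "fps_deriv (fps_map \<kappa> (fps_ln 1)) $ n = ?G $ n"
      by (simp add: fps_map_def fps_ln_nth)
  qed
  then have "fps_deriv (fps_map \<kappa> (fps_ln 1) oo (A - 1)) = fps_deriv C * ((?G oo (A - 1)) * (1 + (A - 1)))"
    by (simp add: fps_deriv_compose A0 deriv mult_ac)
  also have "\<dots> = fps_deriv C"
    by (subst geometric_compose) (simp_all add: A0)
  finally show "fps_deriv (fps_map \<kappa> (fps_ln 1) oo (A - 1)) = fps_deriv C" .
qed (simp add: fps_map_def hom_zero C0)

section \<open>Products and derivatives of exponential generating functions\<close>

definition egf :: "(nat \<Rightarrow> 'a) \<Rightarrow> 'a fps" where
  "egf a = Abs_fps (\<lambda>n. a n * \<kappa> (1 / fact n))"

lemma egf_deriv: "fps_deriv (egf a) = egf (\<lambda>n. a (Suc n))"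
proof (rule fps_ext)
  fix n
  have "of_nat (Suc n) * (a (Suc n) * \<kappa> (1 / fact (Suc n))) = a (Suc n) * \<kappa> (1 / fact n)"
    by (metis of_nat_fact_Suc mult.left_commute)
  then show "fps_deriv (egf a) $ n = egf (\<lambda>n. a (Suc n)) $ n"
    by (simp add: egf_def del: fact_Suc of_nat_Suc)
qed

lemma egf_mult: "egf a * egf b = egf (\<lambda>n. \<Sum>k=0..n. of_nat (n choose k) * a k * b (n - k))"
proof (rule fps_ext)
  fix n
  have *: "\<kappa> (1 / fact k) * \<kappa> (1 / fact (n - k)) = of_nat (n choose k) * \<kappa> (1 / fact n)"
    if "k \<le> n" for k
    using that by (simp add: binomial_fact flip: hom_mult hom_of_nat)
  have "(egf a * egf b) $ n = (\<Sum>k=0..n. a k * b (n - k) * (\<kappa> (1 / fact k) * \<kappa> (1 / fact (n - k))))"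
    by (simp add: egf_def fps_mult_nth mult_ac)
  also have "\<dots> = (\<Sum>k=0..n. of_nat (n choose k) * a k * b (n - k)) * \<kappa> (1 / fact n)"
    unfolding sum_distrib_right by (intro sum.cong refl) (auto simp: * mult_ac)
  finally show "(egf a * egf b) $ n
      = egf (\<lambda>n. \<Sum>k=0..n. of_nat (n choose k) * a k * b (n - k)) $ n"
    by (simp add: egf_def)
qed

text \<open>Combinatorially, one of n + 1 points is distinguished, and \<open>k\<close> is the
  number of other points in the piece (block or component) that contains it.\<close>

lemma egf_deriv_eq:
  assumes "\<And>n. a (Suc n) = (\<Sum>k=0..n. of_nat (n choose k) * c (Suc k) * a (n - k))"
  shows "fps_deriv (egf a) = fps_deriv (egf c) * egf a"
  by (simp add: egf_deriv egf_mult assms)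

end


section \<open>Invariance under isomorphism\<close>

lemma edge_subset_ends: "e \<in> edges G \<Longrightarrow> e \<subseteq> ends G"
  by (auto simp: ends_def)

lemma att_in_verts: "is_mgraph G \<Longrightarrow> h \<in> ends G \<Longrightarrow> att G h \<in> verts G"
  by (auto simp: is_mgraph_def)

lemma finite_ends: "is_mgraph G \<Longrightarrow> finite (ends G)"
  unfolding is_mgraph_def ends_def by (metis card.infinite finite_Union zero_neq_numeral)

section \<open>Composition and inversion of isomorphisms\<close>

lemma is_isoD:
  assumes "is_iso \<phi> \<psi> G K"
  shows "bij_betw \<phi> (verts G) (verts K)" "bij_betw \<psi> (ends G) (ends K)"
    "(\<lambda>e. \<psi> ` e) ` edges G = edges K" "\<And>h. h \<in> ends G \<Longrightarrow> att K (\<psi> h) = \<phi> (att G h)"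
  using assms by (auto simp: is_iso_def)

lemma is_iso_comp:
  assumes "is_iso \<phi> \<psi> G K" "is_iso \<phi>' \<psi>' K L"
  shows "is_iso (\<phi>' \<circ> \<phi>) (\<psi>' \<circ> \<psi>) G L"
proof -
  note G = is_isoD[OF assms(1)] and K = is_isoD[OF assms(2)]
  have "(\<lambda>e. (\<psi>' \<circ> \<psi>) ` e) ` edges G = edges L"
    unfolding G(3)[symmetric] K(3)[symmetric] by (simp add: image_image image_comp)
  moreover have "\<psi> h \<in> ends K" if "h \<in> ends G" for h
    using G(2) that by (auto simp: bij_betw_def)
  ultimately show ?thesis
    using bij_betw_trans[OF G(1) K(1)] bij_betw_trans[OF G(2) K(2)] G(4) K(4)
    by (auto simp: is_iso_def)
qed

text \<open>Lets an isomorphism be normalized outside the graph: to the identity for automorphisms,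
  to \<open>undefined\<close> for extensional maps of ends.\<close>

lemma is_iso_cong:
  assumes "is_mgraph G" "is_iso \<phi> \<psi> G K"
    and "\<And>v. v \<in> verts G \<Longrightarrow> \<phi> v = \<phi>' v" "\<And>h. h \<in> ends G \<Longrightarrow> \<psi> h = \<psi>' h"
  shows "is_iso \<phi>' \<psi>' G K"
proof -
  note G = is_isoD[OF assms(2)]
  have "(\<lambda>e. \<psi>' ` e) ` edges G = (\<lambda>e. \<psi> ` e) ` edges G"
    by (intro image_cong refl) (metis assms(4) edge_subset_ends subsetD)
  then show ?thesis
    using G assms bij_betw_cong[of "verts G" \<phi> \<phi>'] bij_betw_cong[of "ends G" \<psi> \<psi>']
      att_in_verts[OF assms(1)]
    by (auto simp: is_iso_def)
qed

lemma is_iso_inv: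
  assumes "is_mgraph G" "is_iso \<phi> \<psi> G K"
  shows "is_iso (inv_into (verts G) \<phi>) (inv_into (ends G) \<psi>) K G"
proof -
  note G = is_isoD[OF assms(2)]
  let ?\<psi> = "inv_into (ends G) \<psi>"
  have inj: "inj_on \<psi> (ends G)" using G(2) by (simp add: bij_betw_def)
  have "(\<lambda>e. ?\<psi> ` e) ` edges K = (\<lambda>e. ?\<psi> ` \<psi> ` e) ` edges G"
    unfolding G(3)[symmetric] image_image ..
  also have "\<dots> = (\<lambda>e. e) ` edges G"
    by (intro image_cong refl) (metis edge_subset_ends inj inv_into_image_cancel)
  finally have "(\<lambda>e. ?\<psi> ` e) ` edges K = edges G" by simp
  moreover have "att G (?\<psi> h) = inv_into (verts G) \<phi> (att K h)" if "h \<in> ends K" for h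
  proof -
    have "?\<psi> h \<in> ends G" "\<psi> (?\<psi> h) = h"
      using that G(2) by (auto simp: bij_betw_def inv_into_into f_inv_into_f)
    then show ?thesis
      using G(1,4) att_in_verts[OF assms(1)] by (metis bij_betw_inv_into_left)
  qed
  ultimately show ?thesis
    using bij_betw_inv_into[OF G(1)] bij_betw_inv_into[OF G(2)] by (auto simp: is_iso_def)
qed

section \<open>Invariants of isomorphism\<close>

lemma is_mgraph_iso:
  assumes "is_mgraph G" "is_iso \<phi> \<psi> G K"
  shows "is_mgraph K"
proof -
  note G = is_isoD[OF assms(2)]
  have inj: "inj_on \<psi> (ends G)" using G(2) by (simp add: bij_betw_def)
  have "card (\<psi> ` e) = 2" if "e \<in> edges G" for e
    using that assms(1) card_image[OF inj_on_subset[OF inj edge_subset_ends[OF that]]]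
    by (simp add: is_mgraph_def)
  moreover have "disjoint ((\<lambda>e. \<psi> ` e) ` edges G)"
    using disjoint_image[of \<psi> "edges G"] inj assms(1) by (simp add: ends_def is_mgraph_def)
  moreover have "att K ` ends K \<subseteq> verts K"
  proof safe
    fix k assume "k \<in> ends K"
    then obtain h where "h \<in> ends G" "k = \<psi> h" using G(2) by (auto simp: bij_betw_def)
    then show "att K k \<in> verts K"
      using G(1,4) att_in_verts[OF assms(1)] by (auto simp: bij_betw_def)
  qed
  moreover have "finite (verts K)"
    using G(1) assms(1) bij_betw_finite by (auto simp: is_mgraph_def)
  ultimately show ?thesis
    using assms(1) G(3) unfolding is_mgraph_def by (metis (no_types, lifting) finite_imageI imageE)
qed

lemma vdegree_iso:
  assumes "is_mgraph G" "is_iso \<phi> \<psi> G K" "v \<in> verts G"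
  shows "vdegree K (\<phi> v) = vdegree G v"
proof -
  note G = is_isoD[OF assms(2)]
  have "{h \<in> ends K. att K h = \<phi> v} = \<psi> ` {h \<in> ends G. att G h = v}"
    using G(2) assms(3) att_in_verts[OF assms(1)] inj_onD[OF bij_betw_imp_inj_on[OF G(1)]]
    by (auto simp: bij_betw_def G(4)[symmetric] image_iff) (metis G(4) imageE)
  moreover have "inj_on \<psi> {h \<in> ends G. att G h = v}"
    using G(2) by (auto simp: bij_betw_def inj_on_def)
  ultimately show ?thesis by (simp add: vdegree_def card_image)
qed

lemma has_profile_iso:
  assumes "is_mgraph G" "is_iso \<phi> \<psi> G K" "has_profile G n"
  shows "has_profile K n"
proof -
  have "card {v \<in> verts K. vdegree K v = k} = card {v \<in> verts G. vdegree G v = k}" for k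
  proof -
    have "bij_betw \<phi> {v \<in> verts G. vdegree G v = k} {v \<in> verts K. vdegree K v = k}"
      using is_isoD(1)[OF assms(2)] vdegree_iso[OF assms(1,2)]
      by (auto simp: bij_betw_def inj_on_def image_iff) (metis imageE)
    then show ?thesis by (simp add: bij_betw_same_card)
  qed
  then show ?thesis using assms(3) by (simp add: has_profile_def)
qed

lemma connected_mgraph_iso:
  assumes "is_mgraph G" "is_iso \<phi> \<psi> G K" "connected_mgraph G"
  shows "connected_mgraph K"
proof -
  note G = is_isoD[OF assms(2)]
  have att: "att K ` \<psi> ` e = \<phi> ` att G ` e" if "e \<in> edges G" for e
    using G(4) edge_subset_ends[OF that] by (force simp: image_iff)
  have "(\<phi> u, \<phi> v) \<in> adjacent K" if uv: "(u, v) \<in> adjacent G" for u v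
  proof -
    obtain e where "e \<in> edges G" "att G ` e = {u, v}" using uv unfolding adjacent_def by blast
    then have "\<psi> ` e \<in> edges K" "att K ` \<psi> ` e = {\<phi> u, \<phi> v}"
      using G(3) att by auto
    then show ?thesis by (auto simp: adjacent_def)
  qed
  note step = this
  have "(\<phi> u, \<phi> v) \<in> (adjacent K)\<^sup>*" if path: "(u, v) \<in> (adjacent G)\<^sup>*" for u v
    using path by (induction rule: rtrancl_induct) (auto intro: rtrancl_into_rtrancl step)
  moreover have "verts K = \<phi> ` verts G" using G(1) by (simp add: bij_betw_def)
  ultimately show ?thesis
    using assms(3) by (auto simp: connected_mgraph_def)
qed

text \<open>\<open>\<psi>\<close> maps the edges counted at \<open>v\<close> bijectively to those
  counted at \<open>\<phi> v\<close>; injectivity of \<open>\<phi>\<close> keeps loops apart from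
  proper edges. The colorings are compared on vertices only, since those in \<open>W_poly\<close>
  are cut off elsewhere.\<close>

lemma even_white_iso:
  assumes "is_mgraph G" "is_iso \<phi> \<psi> G K" "v \<in> verts G"
    and c: "\<And>u. u \<in> verts G \<Longrightarrow> d u = c (\<phi> u)"
  shows "even_white G d v \<longleftrightarrow> even_white K c (\<phi> v)"
proof -
  note G = is_isoD[OF assms(2)]
  have inj\<phi>: "inj_on \<phi> (verts G)" and im: "verts K = \<phi> ` verts G"
    using G(1) by (auto simp: bij_betw_def)
  have inj\<psi>: "inj_on \<psi> (ends G)" using G(2) by (auto simp: bij_betw_def)
  let ?E = "{e \<in> edges G. \<exists>u\<in>verts G. u \<noteq> v \<and> d u = 1 \<and> att G ` e = {v, u}}"
  let ?E' = "{e \<in> edges K. \<exists>u\<in>verts K. u \<noteq> \<phi> v \<and> c u = 1 \<and> att K ` e = {\<phi> v, u}}"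
  have eq: "att K ` \<psi> ` e = {\<phi> v, \<phi> u} \<longleftrightarrow> att G ` e = {v, u}"
    if "e \<in> edges G" "u \<in> verts G" for e u
  proof -
    have "att K ` \<psi> ` e = \<phi> ` att G ` e"
      using G(4) edge_subset_ends[OF that(1)] by (force simp: image_iff)
    moreover have "att G ` e \<subseteq> verts G"
      using att_in_verts[OF assms(1)] edge_subset_ends[OF that(1)] by auto
    ultimately show ?thesis
      using inj_on_image_eq_iff[OF inj\<phi>, of "att G ` e" "{v, u}"] that assms(3) by auto
  qed
  have ne: "\<phi> u \<noteq> \<phi> v \<longleftrightarrow> u \<noteq> v" if "u \<in> verts G" for u
    using inj\<phi> that assms(3) by (auto simp: inj_on_def)
  have "?E' = (\<lambda>e. \<psi> ` e) ` ?E"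
    unfolding G(3)[symmetric] im using eq ne c by (auto simp: image_iff) blast
  moreover have "inj_on (\<lambda>e. \<psi> ` e) ?E"
    by (rule inj_onI) (metis (lifting) edge_subset_ends inj\<psi> inj_on_image_eq_iff mem_Collect_eq)
  ultimately have "card ?E' = card ?E" by (simp add: card_image)
  then show ?thesis using c[OF assms(3)] by (simp add: even_white_def)
qed

text \<open>Colorings are transported along \<open>\<phi>\<close> and its inverse. Each transport is
  followed by \<open>restrict\<close>, because the sum ranges over extensional functions.\<close>

lemma W_poly_iso:
  assumes "is_mgraph G" "is_iso \<phi> \<psi> G K"
  shows "W_poly G t = W_poly K t"
proof -
  note G = is_isoD[OF assms(2)]
  let ?i = "inv_into (verts G) \<phi>"
  have i: "?i w \<in> verts G" "\<phi> (?i w) = w" if "w \<in> verts K" for w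
    using G(1) that by (auto simp: bij_betw_def inv_into_into f_inv_into_f)
  have i': "\<phi> v \<in> verts K" "?i (\<phi> v) = v" if "v \<in> verts G" for v
    using G(1) that by (auto simp: bij_betw_def inv_into_into)
  have card: "card {v \<in> verts K. even_white K c v} = card {v \<in> verts G. even_white G d v}"
    if "\<And>u. u \<in> verts G \<Longrightarrow> d u = c (\<phi> u)" for c d
  proof -
    have "bij_betw \<phi> {v \<in> verts G. even_white G d v} {v \<in> verts K. even_white K c v}"
      using G(1) even_white_iso[where c = c and d = d, OF assms _ that]
      by (auto simp: bij_betw_def inj_on_def image_iff) (metis imageE)
    then show ?thesis by (simp add: bij_betw_same_card)
  qed
  show ?thesis unfolding W_poly_def
  proof (rule sum.reindex_bij_witness)
    fix c assume c: "c \<in> verts K \<rightarrow>\<^sub>E {0, 1::nat}"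
    show "restrict (\<lambda>w. restrict (c \<circ> \<phi>) (verts G) (?i w)) (verts K) = c"
      using c i by (auto simp: fun_eq_iff PiE_def extensional_def)
    show "restrict (c \<circ> \<phi>) (verts G) \<in> verts G \<rightarrow>\<^sub>E {0, 1::nat}"
      using c i' by (auto simp: PiE_def Pi_def)
  next
    fix c assume c: "c \<in> verts G \<rightarrow>\<^sub>E {0, 1::nat}"
    show "restrict ((\<lambda>w\<in>verts K. c (?i w)) \<circ> \<phi>) (verts G) = c"
      using c i' by (auto simp: fun_eq_iff PiE_def extensional_def)
    show "(\<lambda>w\<in>verts K. c (?i w)) \<in> verts K \<rightarrow>\<^sub>E {0, 1::nat}"
      using c i by (auto simp: PiE_def Pi_def)
    show "t ^ card {v \<in> verts K. even_white K (\<lambda>w\<in>verts K. c (?i w)) v} =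
        t ^ card {v \<in> verts G. even_white G c v}"
      using card[of c "\<lambda>w\<in>verts K. c (?i w)"] i' by simp
  qed
qed


section \<open>Graphs as pairs of partitions of the ends\<close>

definition matchings :: "'h set \<Rightarrow> 'h set set set" where
  "matchings U = {M. partition_on U M \<and> (\<forall>e\<in>M. card e = 2)}"

text \<open>
  A graph without isolated vertices is determined by two partitions of its set of ends: into the
  ends at each vertex, and into edges.  This removes the labels of the vertices from the counting.
\<close>

definition structures :: "'h set \<Rightarrow> ('h set set \<times> 'h set set) set" where
  "structures U = {P. partition_on U P} \<times> matchings U"

text \<open>Each block is its own vertex, so no vertex names have to be chosen; the vertex type is
  therefore \<open>'h set\<close>.\<close>

definition part_graph :: "'h set set \<times> 'h set set \<Rightarrow> ('h set, 'h) mgraph" where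
  "part_graph s = \<lparr>verts = fst s, edges = snd s, att = (\<lambda>h. THE B. B \<in> fst s \<and> h \<in> B)\<rparr>"

lemma part_graph_simps [simp]:
  "verts (part_graph s) = fst s" "edges (part_graph s) = snd s"
  by (simp_all add: part_graph_def)

lemma partition_on_block_unique:
  "partition_on U P \<Longrightarrow> B \<in> P \<Longrightarrow> C \<in> P \<Longrightarrow> h \<in> B \<Longrightarrow> h \<in> C \<Longrightarrow> B = C"
  by (auto simp: partition_on_def disjoint_def)

lemma att_part_graph_eq:
  assumes "partition_on U (fst s)" "B \<in> fst s" "h \<in> B"
  shows "att (part_graph s) h = B"
proof -
  have "(THE B. B \<in> fst s \<and> h \<in> B) = B"
    by (rule the_equality) (use assms partition_on_block_unique[OF assms(1)] in blast)+
  then show ?thesis by (simp add: part_graph_def)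
qed

lemma structuresD:
  assumes "s \<in> structures U"
  shows "partition_on U (fst s)" "partition_on U (snd s)" "\<And>e. e \<in> snd s \<Longrightarrow> card e = 2"
  using assms by (auto simp: structures_def matchings_def)

lemma structuresI:
  assumes "partition_on U P" "partition_on U M" "\<And>e. e \<in> M \<Longrightarrow> card e = 2"
  shows "(P, M) \<in> structures U"
  using assms by (auto simp: structures_def matchings_def)

lemma finite_matchings: "finite U \<Longrightarrow> finite (matchings U)"
  using finitely_many_partition_on[of U] unfolding matchings_def by (rule finite_subset[rotated]) auto

lemma finite_structures: "finite U \<Longrightarrow> finite (structures U)"
  unfolding structures_def by (intro finite_cartesian_product finitely_many_partition_on finite_matchings)

lemma ends_part_graph: "s \<in> structures U \<Longrightarrow> ends (part_graph s) = U"
  by (simp add: ends_def partition_onD1[OF structuresD(2), symmetric])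

lemma att_part_graph:
  assumes "s \<in> structures U" "h \<in> U"
  shows "att (part_graph s) h \<in> fst s" "h \<in> att (part_graph s) h"
proof -
  obtain B where "B \<in> fst s" "h \<in> B"
    using assms(2) partition_onD1[OF structuresD(1)[OF assms(1)]] by blast
  then show "att (part_graph s) h \<in> fst s" "h \<in> att (part_graph s) h"
    using att_part_graph_eq[OF structuresD(1)[OF assms(1)]] by auto
qed

lemma block_subset: "partition_on U P \<Longrightarrow> B \<in> P \<Longrightarrow> B \<subseteq> U"
  by (auto simp: partition_on_def)

lemma att_part_graph_eq_iff:
  assumes "s \<in> structures U" "B \<in> fst s" "h \<in> U"
  shows "att (part_graph s) h = B \<longleftrightarrow> h \<in> B"
  using assms att_part_graph att_part_graph_eq structuresD(1) by metis

lemma is_mgraph_part_graph: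
  assumes "s \<in> structures U" "finite U"
  shows "is_mgraph (part_graph s)"
proof -
  note sD = structuresD[OF assms(1)]
  have "finite (fst s)" "finite (snd s)" using sD(1,2) assms(2) by (blast intro: finite_elements)+
  moreover have "disjoint (snd s)" using sD(2) by (simp add: partition_on_def)
  moreover have "att (part_graph s) ` U \<subseteq> fst s" using att_part_graph(1)[OF assms(1)] by blast
  ultimately show ?thesis
    using sD(3) by (simp add: is_mgraph_def ends_part_graph[OF assms(1)])
qed

lemma vdegree_part_graph:
  assumes "s \<in> structures U" "B \<in> fst s"
  shows "vdegree (part_graph s) B = card B"
proof -
  have "{h \<in> U. att (part_graph s) h = B} = B"
    using att_part_graph_eq_iff[OF assms] block_subset[OF structuresD(1)[OF assms(1)] assms(2)] by auto
  then show ?thesis by (simp add: vdegree_def ends_part_graph[OF assms(1)])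
qed

text \<open>
  The set \<open>cross M (black P c)\<close> consists of the ends of the bichromatic edges.
\<close>

definition black :: "'h set set \<Rightarrow> ('h set \<Rightarrow> nat) \<Rightarrow> 'h set" where
  "black P c = \<Union>{B \<in> P. c B = 1}"

definition cross :: "'h set set \<Rightarrow> 'h set \<Rightarrow> 'h set" where
  "cross M A = \<Union>{e \<in> M. \<not> e \<subseteq> A \<and> e \<inter> A \<noteq> {}}"

lemma mem_black_iff:
  "partition_on U P \<Longrightarrow> B \<in> P \<Longrightarrow> h \<in> B \<Longrightarrow> h \<in> black P c \<longleftrightarrow> c B = 1"
  using partition_on_block_unique[of U P B _ h] unfolding black_def by blast

text \<open>An edge from a white block \<open>B\<close> to a black block has exactly one end in
  \<open>B\<close>, so counting these edges is counting the ends of \<open>B\<close> on bichromatic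
  edges. This turns a condition on edges into one on ends, which can be matched with exponents in
  \<open>F_poly\<close>.\<close>

lemma even_white_part_graph:
  assumes s: "s \<in> structures U" and B: "B \<in> fst s"
  shows "even_white (part_graph s) c B \<longleftrightarrow>
    c B = 0 \<and> even (card (B \<inter> cross (snd s) (black (fst s) c)))"
proof (cases "c B = 0")
  case True
  note sD = structuresD[OF s]
  let ?a = "att (part_graph s)" and ?A = "black (fst s) c"
  let ?E = "{e \<in> snd s. \<exists>u\<in>fst s. u \<noteq> B \<and> c u = 1 \<and> ?a ` e = {B, u}}"
  let ?X = "B \<inter> cross (snd s) ?A"
  have BA: "B \<inter> ?A = {}" using mem_black_iff[OF sD(1) B] True by auto
  have attA: "c (?a k) = 1 \<longleftrightarrow> k \<in> ?A" if "k \<in> U" for k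
    using mem_black_iff[OF sD(1)] att_part_graph[OF s that] by blast
  have "card ?E = card ?X"
  \<comment> \<open>Each edge is sent to its end in \<open>B\<close>. The description is unique
    because the other end is black and \<open>B\<close>, being white, contains no black end.\<close>
  proof (rule bij_betw_same_card[of "\<lambda>e. THE h. h \<in> e \<inter> B"], rule bij_betw_imageI)
    have E: "\<exists>h k. e = {h, k} \<and> h \<in> B \<and> k \<in> ?A \<and> (THE h. h \<in> e \<inter> B) = h" if "e \<in> ?E" for e
    proof -
      obtain u where u: "e \<in> snd s" "u \<in> fst s" "u \<noteq> B" "c u = 1" "?a ` e = {B, u}"
        using \<open>e \<in> ?E\<close> by auto
      obtain h k where hk: "h \<in> e" "?a h = B" "k \<in> e" "?a k = u" using u(5) by (metis image_iff insertCI)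
      have "h \<noteq> k" using hk u(3) by auto
      have e: "e = {h, k}"
        using hk \<open>h \<noteq> k\<close> sD(3)[OF u(1)] by (auto simp: card_2_iff)
      have "h \<in> U" "k \<in> U" using hk block_subset[OF sD(2) u(1)] by auto
      then have "h \<in> B" "k \<in> ?A" using hk u(4) att_part_graph(2)[OF s] attA by auto
      then have "e \<inter> B = {h}" using e BA by auto
      then have "(THE h. h \<in> e \<inter> B) = h" by simp
      with e \<open>h \<in> B\<close> \<open>k \<in> ?A\<close>
      have "e = {h, k} \<and> h \<in> B \<and> k \<in> ?A \<and> (THE h. h \<in> e \<inter> B) = h"
        by (intro conjI)
      then have "\<exists>k. e = {h, k} \<and> h \<in> B \<and> k \<in> ?A \<and> (THE h. h \<in> e \<inter> B) = h" by (rule exI)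
      then show ?thesis by (rule exI)
    qed
    show "inj_on (\<lambda>e. THE h. h \<in> e \<inter> B) ?E"
    proof (rule inj_onI)
      fix e e' assume "e \<in> ?E" "e' \<in> ?E" "(THE h. h \<in> e \<inter> B) = (THE h. h \<in> e' \<inter> B)"
      moreover have "(THE h. h \<in> e \<inter> B) \<in> e" using E[OF \<open>e \<in> ?E\<close>] by (metis insertI1)
      moreover have "(THE h. h \<in> e' \<inter> B) \<in> e'" using E[OF \<open>e' \<in> ?E\<close>] by (metis insertI1)
      ultimately show "e = e'" using partition_on_block_unique[OF sD(2), of e e'] by simp
    qed
    show "(\<lambda>e. THE h. h \<in> e \<inter> B) ` ?E = ?X"
    proof (intro subset_antisym subsetI)
      fix h assume "h \<in> (\<lambda>e. THE h. h \<in> e \<inter> B) ` ?E"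
      then obtain e where e: "e \<in> ?E" "h = (THE h. h \<in> e \<inter> B)" by auto
      obtain h' k where hk: "e = {h', k}" "h' \<in> B" "k \<in> ?A" "(THE h. h \<in> e \<inter> B) = h'"
        using E[OF e(1)] by blast
      have "e \<in> snd s" "h = h'" using e hk(4) by simp_all
      moreover have "h' \<notin> ?A" using hk BA by blast
      ultimately have "e \<in> {e \<in> snd s. \<not> e \<subseteq> ?A \<and> e \<inter> ?A \<noteq> {}}" "h \<in> e" using hk by simp_all
      then have "h \<in> cross (snd s) ?A" unfolding cross_def by (rule UnionI)
      then show "h \<in> ?X" using hk \<open>h = h'\<close> by simp
    next
      fix h assume h: "h \<in> ?X"
      then obtain e where e: "e \<in> snd s" "h \<in> e" "e \<inter> ?A \<noteq> {}" by (auto simp: cross_def)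
      obtain k where k: "k \<in> e" "k \<in> ?A" using e by auto
      have "h \<noteq> k" using h k BA by auto
      have eq: "e = {h, k}"
        using k e \<open>h \<noteq> k\<close> sD(3)[OF e(1)] by (auto simp: card_2_iff)
      have hkU: "h \<in> U" "k \<in> U" using e k block_subset[OF sD(2) e(1)] by auto
      have "?a h = B" "?a k \<noteq> B" "c (?a k) = 1" "?a k \<in> fst s"
        using h k BA att_part_graph_eq_iff[OF s B] hkU attA att_part_graph(1)[OF s] True by auto
      moreover have "?a ` e = {?a h, ?a k}" using eq by simp
      ultimately have "e \<in> ?E" using e(1) by (intro CollectI conjI bexI[of _ "?a k"]) simp_all
      moreover have "e \<inter> B = {h}" using eq h k BA by auto
      then have "(THE h. h \<in> e \<inter> B) = h" by auto
      ultimately show "h \<in> (\<lambda>e. THE h. h \<in> e \<inter> B) ` ?E" by (intro image_eqI[of _ _ e]) simp_all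
    qed
  qed
  then show ?thesis by (simp add: even_white_def True)
qed (simp add: even_white_def)

lemma W_poly_part_graph:
  assumes "s \<in> structures U"
  shows "W_poly (part_graph s) t = (\<Sum>c\<in>fst s \<rightarrow>\<^sub>E {0, 1}.
    t ^ card {B \<in> fst s. c B = 0 \<and> even (card (B \<inter> cross (snd s) (black (fst s) c)))})"
  unfolding W_poly_def part_graph_simps
  by (intro sum.cong refl arg_cong[where f = "\<lambda>A. t ^ card A"] Collect_cong)
    (auto simp: even_white_part_graph[OF assms])

text \<open>A path-free substitute for reachability: the saturated subsets of \<open>U\<close> are
  the end sets of unions of connected components. Blocks and edges are treated alike, as sets of
  ends that must not be cut.\<close>

definition saturated :: "'h set set \<times> 'h set set \<Rightarrow> 'h set \<Rightarrow> bool" where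
  "saturated s K \<longleftrightarrow> (\<forall>B\<in>fst s \<union> snd s. B \<subseteq> K \<or> B \<inter> K = {})"

text \<open>A path cannot leave a saturated set. Conversely, the blocks reachable from a given one
  have a saturated nonempty union, which must then be all of \<open>U\<close>.\<close>

lemma connected_part_graph_iff:
  assumes s: "s \<in> structures U"
  shows "connected_mgraph (part_graph s) \<longleftrightarrow>
    U \<noteq> {} \<and> (\<forall>K\<subseteq>U. saturated s K \<longrightarrow> K = {} \<or> K = U)" (is "?L \<longleftrightarrow> ?R")
proof
  note sD = structuresD[OF s]
  let ?a = "att (part_graph s)"
  {
    assume L: ?L
    then have "fst s \<noteq> {}" by (simp add: connected_mgraph_def)
    then have "U \<noteq> {}" using sD(1) by (auto simp: partition_on_def)
    moreover have "K = U" if K: "K \<subseteq> U" "saturated s K" "h \<in> K" for K h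
    proof -
      have step: "v \<subseteq> K" if uv: "(u, v) \<in> adjacent (part_graph s)" "u \<subseteq> K" for u v
      proof -
        obtain e where e: "e \<in> snd s" "?a ` e = {u, v}" using uv(1) by (simp add: adjacent_def) metis
        obtain h k where hk: "h \<in> e" "?a h = u" "k \<in> e" "?a k = v" using e(2) by (metis image_iff insertCI)
        have hkU: "h \<in> U" "k \<in> U" using hk block_subset[OF sD(2) e(1)] by auto
        have "h \<in> K" using att_part_graph[OF s hkU(1)] hk uv by auto
        then have "k \<in> K" using K(2) e hk by (auto simp: saturated_def)
        then show ?thesis
          using att_part_graph[OF s hkU(2)] hk K(2) by (auto simp: saturated_def)
      qed
      have "h \<in> U" using K by auto
      have start: "?a h \<in> fst s" "?a h \<subseteq> K"
        using K att_part_graph[OF s \<open>h \<in> U\<close>] by (auto simp: saturated_def)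
      have "B \<subseteq> K" if "B \<in> fst s" for B
      proof -
        have "(?a h, B) \<in> (adjacent (part_graph s))\<^sup>*"
          using L start that by (auto simp: connected_mgraph_def)
        then show ?thesis by (induction rule: rtrancl_induct) (use start step in auto)
      qed
      then show ?thesis using sD(1) K by (auto simp: partition_on_def)
    qed
    ultimately show ?R by blast
  }
  assume R: ?R
  have "(u, v) \<in> (adjacent (part_graph s))\<^sup>*" if uv: "u \<in> fst s" "v \<in> fst s" for u v
  proof -
    define R where "R = {B \<in> fst s. (u, B) \<in> (adjacent (part_graph s))\<^sup>*}"
    have RU: "\<Union>R \<subseteq> U" using sD(1) by (auto simp: R_def partition_on_def)
    have mem: "h \<in> \<Union>R \<longleftrightarrow> ?a h \<in> R" if "h \<in> U" for h
    proof
      assume "h \<in> \<Union>R"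
      then obtain C where "C \<in> R" "h \<in> C" by blast
      then show "?a h \<in> R" using att_part_graph_eq[OF sD(1), of C h] by (simp add: R_def)
    next
      assume "?a h \<in> R"
      then show "h \<in> \<Union>R" using att_part_graph(2)[OF s that] by blast
    qed
    have sat: "saturated s (\<Union>R)" unfolding saturated_def
    proof
      fix B assume "B \<in> fst s \<union> snd s"
      then show "B \<subseteq> \<Union>R \<or> B \<inter> \<Union>R = {}"
      proof
        assume "B \<in> fst s"
        then show ?thesis using partition_on_block_unique[OF sD(1)] by (auto simp: R_def)
      next
        assume e: "B \<in> snd s"
        have "k \<in> \<Union>R" if "h \<in> B" "h \<in> \<Union>R" "k \<in> B" for h k
        proof -
          have U: "h \<in> U" "k \<in> U" using that e block_subset[OF sD(2)] by auto
          show ?thesis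
          proof (cases "h = k")
            case False
            then have "B = {h, k}" using that sD(3)[OF e] by (auto simp: card_2_iff)
            then have "?a ` B = {?a h, ?a k}" by simp
            then have "(?a h, ?a k) \<in> adjacent (part_graph s)"
              unfolding adjacent_def using e by (intro CollectI case_prodI bexI[of _ B]) simp_all
            moreover have "(u, ?a h) \<in> (adjacent (part_graph s))\<^sup>*"
              using mem[OF U(1)] that by (simp add: R_def)
            ultimately have "?a k \<in> R" using att_part_graph(1)[OF s U(2)] by (simp add: R_def)
            then show ?thesis using mem[OF U(2)] by simp
          qed (use that in simp)
        qed
        then show ?thesis by blast
      qed
    qed
    have "u \<in> R" using uv by (simp add: R_def)
    moreover have "u \<noteq> {}" using uv partition_onD3[OF sD(1)] by blast
    ultimately have "\<Union>R \<noteq> {}" by blast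
    then have "\<Union>R = U" using R RU sat by metis
    moreover obtain h where "h \<in> v" using uv sD(1) by (force simp: partition_on_def)
    ultimately have "h \<in> \<Union>R" "h \<in> U" using uv block_subset[OF sD(1)] by auto
    then have "?a h \<in> R" using mem by blast
    moreover have "?a h = v" using att_part_graph_eq[OF sD(1) uv(2) \<open>h \<in> v\<close>] .
    ultimately show ?thesis by (simp add: R_def)
  qed
  moreover have "fst s \<noteq> {}" using R sD(1) by (auto simp: partition_on_def)
  ultimately show ?L by (simp add: connected_mgraph_def)
qed


section \<open>Splitting off a connected component\<close>

definition map_structure :: "('h \<Rightarrow> 'k) \<Rightarrow> 'h set set \<times> 'h set set \<Rightarrow> 'k set set \<times> 'k set set" where
  "map_structure f s = ((\<lambda>B. f ` B) ` fst s, (\<lambda>e. f ` e) ` snd s)"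

lemma partition_on_image:
  assumes "bij_betw f U V" "partition_on U P"
  shows "partition_on V ((\<lambda>B. f ` B) ` P)"
proof -
  have "\<Union>((\<lambda>B. f ` B) ` P) = f ` \<Union>P" by blast
  moreover have "disjoint ((\<lambda>B. f ` B) ` P)"
    using disjoint_image[of f P] assms by (simp add: partition_on_def bij_betw_def)
  ultimately show ?thesis
    using assms by (auto simp: partition_on_def bij_betw_def)
qed

lemma image_blocks_cancel:
  assumes "partition_on U P" "\<And>h. h \<in> U \<Longrightarrow> g (f h) = h"
  shows "(\<lambda>B. g ` B) ` (\<lambda>B. f ` B) ` P = P"
proof -
  have "g ` f ` B = B" if "B \<in> P" for B
    using block_subset[OF assms(1) that] assms(2) by (force simp: image_iff)
  then show ?thesis by (simp add: image_image cong: image_cong)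
qed

lemma map_structure_structures:
  assumes "bij_betw f U V" "s \<in> structures U"
  shows "map_structure f s \<in> structures V"
  unfolding map_structure_def
proof (rule structuresI)
  fix e assume "e \<in> (\<lambda>e. f ` e) ` snd s"
  then obtain d where d: "d \<in> snd s" "e = f ` d" by blast
  have "inj_on f d"
    using assms(1) block_subset[OF structuresD(2)[OF assms(2)] d(1)]
    by (auto simp: bij_betw_def intro: inj_on_subset)
  then show "card e = 2" using d structuresD(3)[OF assms(2) d(1)] by (simp add: card_image)
qed (use assms partition_on_image structuresD in blast)+

lemma is_iso_map_structure:
  assumes f: "bij_betw f U V" and s: "s \<in> structures U"
  shows "is_iso (\<lambda>B. f ` B) f (part_graph s) (part_graph (map_structure f s))"
proof -
  note sV = map_structure_structures[OF f s] and sD = structuresD[OF s]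
  have "inj_on (\<lambda>B. f ` B) (fst s)"
    by (rule inj_onI) (metis block_subset sD(1) bij_betw_imp_inj_on f inj_on_image_eq_iff)
  moreover have "att (part_graph (map_structure f s)) (f h) = f ` att (part_graph s) h" if "h \<in> U" for h
    using att_part_graph[OF s that]
    by (intro att_part_graph_eq[OF structuresD(1)[OF sV]]) (auto simp: map_structure_def)
  ultimately show ?thesis
    unfolding is_iso_def ends_part_graph[OF s] ends_part_graph[OF sV]
    using f by (auto simp: map_structure_def bij_betw_def)
qed

lemma map_structure_cancel:
  assumes "s \<in> structures U" "\<And>h. h \<in> U \<Longrightarrow> g (f h) = h"
  shows "map_structure g (map_structure f s) = s"
  using image_blocks_cancel[OF structuresD(1)[OF assms(1)], of g f]
    image_blocks_cancel[OF structuresD(2)[OF assms(1)], of g f] assms(2)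
  by (simp add: map_structure_def)

lemma bij_betw_map_structure:
  assumes f: "bij_betw f U V"
  shows "bij_betw (map_structure f) (structures U) (structures V)"
proof (rule bij_betwI[where g = "map_structure (inv_into U f)"])
  show "map_structure f \<in> structures U \<rightarrow> structures V"
    using map_structure_structures[OF f] by blast
  show "map_structure (inv_into U f) \<in> structures V \<rightarrow> structures U"
    using map_structure_structures[OF bij_betw_inv_into[OF f]] by blast
qed (use f in \<open>auto intro!: map_structure_cancel simp: bij_betw_inv_into_left bij_betw_inv_into_right\<close>)

text \<open>The summand of the graph series without its automorphism factor, which orbit counting
  supplies. \<open>card B\<close> is the degree of the vertex \<open>B\<close>, so the product is
  the \<xi>-monomial of the profile.\<close>

definition weight :: "'h set set \<times> 'h set set \<Rightarrow> coeff_ring" where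
  "weight s = W_poly (part_graph s) t_ind * (\<Prod>B\<in>fst s. xi (card B))"

definition total_weight :: "'h set \<Rightarrow> coeff_ring" where
  "total_weight U = (\<Sum>s\<in>structures U. weight s)"

definition connected_weight :: "'h set \<Rightarrow> coeff_ring" where
  "connected_weight U = (\<Sum>s | s \<in> structures U \<and> connected_mgraph (part_graph s). weight s)"

lemma weight_map_structure:
  assumes f: "bij_betw f U V" and "finite U" and s: "s \<in> structures U"
  shows "weight (map_structure f s) = weight s"
proof -
  note iso = is_iso_map_structure[OF f s]
  have "(\<Prod>B\<in>fst (map_structure f s). xi (card B)) = (\<Prod>B\<in>fst s. xi (card (f ` B)))"
    using is_isoD(1)[OF iso] by (simp add: map_structure_def bij_betw_def prod.reindex)
  also have "\<dots> = (\<Prod>B\<in>fst s. xi (card B))"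
  proof (intro prod.cong refl arg_cong[where f = xi] card_image)
    fix B assume "B \<in> fst s"
    then show "inj_on f B"
      using f block_subset[OF structuresD(1)[OF s]] by (auto simp: bij_betw_def intro: inj_on_subset)
  qed
  finally show ?thesis
    by (simp add: weight_def W_poly_iso[OF is_mgraph_part_graph[OF s assms(2)] iso])
qed

lemma connected_map_structure:
  assumes f: "bij_betw f U V" and "finite U" and s: "s \<in> structures U"
  shows "connected_mgraph (part_graph (map_structure f s)) \<longleftrightarrow> connected_mgraph (part_graph s)"
  using connected_mgraph_iso is_iso_map_structure[OF f s] is_mgraph_part_graph[OF s assms(2)]
    is_iso_inv is_mgraph_iso by metis

lemma total_weight_cong:
  assumes f: "bij_betw f U V" and "finite U"
  shows "total_weight U = total_weight V"
  using sum.reindex_bij_betw[OF bij_betw_map_structure[OF f], of weight]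
  by (simp add: total_weight_def weight_map_structure[OF assms])

lemma connected_weight_cong:
  assumes f: "bij_betw f U V" and "finite U"
  shows "connected_weight U = connected_weight V"
proof -
  have "bij_betw (map_structure f) {s \<in> structures U. connected_mgraph (part_graph s)}
      {s \<in> structures V. connected_mgraph (part_graph s)}"
    by (rule bij_betw_Collect[OF bij_betw_map_structure[OF f]]) (rule connected_map_structure[OF assms])
  from sum.reindex_bij_betw[OF this, of weight] show ?thesis
    by (simp add: connected_weight_def weight_map_structure[OF assms])
qed

text \<open>Allows every finite set of ends to be replaced by an initial segment of the natural
  numbers.\<close>

lemma weight_card_cong:
  assumes "finite U" "finite V" "card U = card V"
  shows "total_weight U = total_weight V" "connected_weight U = connected_weight V"
  using finite_same_card_bij[OF assms] total_weight_cong connected_weight_cong assms(1) by blast+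

section \<open>Disjoint joins, restrictions and connected components\<close>

definition join :: "'h set set \<times> 'h set set \<Rightarrow> 'h set set \<times> 'h set set \<Rightarrow> 'h set set \<times> 'h set set" where
  "join s s' = (fst s \<union> fst s', snd s \<union> snd s')"

definition restrict_structure :: "'h set \<Rightarrow> 'h set set \<times> 'h set set \<Rightarrow> 'h set set \<times> 'h set set" where
  "restrict_structure K s = ({B \<in> fst s. B \<subseteq> K}, {e \<in> snd s. e \<subseteq> K})"

lemma partition_on_Un:
  assumes "partition_on K P" "partition_on L Q" "K \<inter> L = {}"
  shows "partition_on (K \<union> L) (P \<union> Q)"
  using assms disjoint_union[of P Q] by (auto simp: partition_on_def)

lemma join_structures:
  assumes "s \<in> structures K" "s' \<in> structures L" "K \<inter> L = {}"
  shows "join s s' \<in> structures (K \<union> L)"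
  unfolding join_def
  using structuresD[OF assms(1)] structuresD[OF assms(2)] partition_on_Un[OF _ _ assms(3)]
  by (intro structuresI) auto

lemma partition_on_saturated:
  assumes "partition_on U P" "K \<subseteq> U" "\<And>B. B \<in> P \<Longrightarrow> B \<subseteq> K \<or> B \<inter> K = {}"
  shows "partition_on K {B \<in> P. B \<subseteq> K}"
proof (rule partition_onI)
  show "\<Union>{B \<in> P. B \<subseteq> K} = K" using assms partition_onD1[OF assms(1)] by blast
  show "disjnt B C" if "B \<in> {B \<in> P. B \<subseteq> K}" "C \<in> {B \<in> P. B \<subseteq> K}" "B \<noteq> C" for B C
    using that partition_on_block_unique[OF assms(1), of B C] by (auto simp: disjnt_def)
qed (use partition_onD3[OF assms(1)] in blast)

lemma restrict_structure:
  assumes "s \<in> structures U" "K \<subseteq> U" "saturated s K"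
  shows "restrict_structure K s \<in> structures K"
  unfolding restrict_structure_def using structuresD[OF assms(1)] assms(2,3)
  by (intro structuresI partition_on_saturated) (auto simp: saturated_def)

lemma saturated_Diff: "saturated s K \<Longrightarrow> saturated s L \<Longrightarrow> saturated s (K - L)"
  unfolding saturated_def by (metis Diff_Int_distrib Diff_empty Diff_eq_empty_iff Diff_subset
      Int_Diff Int_absorb2 Int_commute inf.orderE inf_bot_right le_iff_inf)

lemma saturated_whole: "s \<in> structures U \<Longrightarrow> saturated s U"
  using structuresD(1,2)[of s U] block_subset unfolding saturated_def by blast

lemma saturated_Inter: "(\<And>K. K \<in> \<K> \<Longrightarrow> saturated s K) \<Longrightarrow> saturated s (\<Inter>\<K>)"
  unfolding saturated_def by blast

lemma join_restrict:
  assumes "s \<in> structures U" "saturated s K"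
  shows "join (restrict_structure K s) (restrict_structure (U - K) s) = s"
proof -
  have "{B \<in> P. B \<subseteq> K} \<union> {B \<in> P. B \<subseteq> U - K} = P"
    if "partition_on U P" "\<And>B. B \<in> P \<Longrightarrow> B \<subseteq> K \<or> B \<inter> K = {}" for P
    using block_subset[OF that(1)] that(2) by blast
  then show ?thesis
    using structuresD(1,2)[OF assms(1)] assms(2)
    by (simp add: join_def restrict_structure_def saturated_def prod_eq_iff)
qed

lemma restrict_join:
  assumes "s \<in> structures K" "s' \<in> structures L" "K \<inter> L = {}"
  shows "restrict_structure K (join s s') = s" "restrict_structure L (join s s') = s'"
proof -
  have *: "{B \<in> P \<union> Q. B \<subseteq> K} = P \<and> {B \<in> P \<union> Q. B \<subseteq> L} = Q"
    if "partition_on K P" "partition_on L Q" for P Q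
  proof -
    \<comment> \<open>Such a block would lie in the empty set \<open>K \<inter> L\<close>, and
      blocks of a partition are nonempty.\<close>
    have "\<not> B \<subseteq> L" if "B \<in> P" for B
      using that block_subset[OF \<open>partition_on K P\<close>] partition_onD3[OF \<open>partition_on K P\<close>] assms(3)
      by (metis Int_subset_iff subset_empty)
    moreover have "\<not> B \<subseteq> K" if "B \<in> Q" for B
      using that block_subset[OF \<open>partition_on L Q\<close>] partition_onD3[OF \<open>partition_on L Q\<close>] assms(3)
      by (metis Int_subset_iff subset_empty)
    ultimately show ?thesis using block_subset[OF that(1)] block_subset[OF that(2)] by blast
  qed
  show "restrict_structure K (join s s') = s" "restrict_structure L (join s s') = s'"
    using *[OF structuresD(1)[OF assms(1)] structuresD(1)[OF assms(2)]]
      *[OF structuresD(2)[OF assms(1)] structuresD(2)[OF assms(2)]]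
    by (simp_all add: join_def restrict_structure_def prod_eq_iff)
qed

definition component :: "'h set \<Rightarrow> 'h \<Rightarrow> 'h set set \<times> 'h set set \<Rightarrow> 'h set" where
  "component U x s = \<Inter>{K. K \<subseteq> U \<and> saturated s K \<and> x \<in> K}"

lemma component:
  assumes "s \<in> structures U" "x \<in> U"
  shows "component U x s \<subseteq> U" "saturated s (component U x s)" "x \<in> component U x s"
    and "\<And>K. K \<subseteq> U \<Longrightarrow> saturated s K \<Longrightarrow> x \<in> K \<Longrightarrow> component U x s \<subseteq> K"
proof -
  show "component U x s \<subseteq> U"
    unfolding component_def using saturated_whole[OF assms(1)] assms(2) by blast
  show "saturated s (component U x s)"
    unfolding component_def by (rule saturated_Inter) blast
qed (auto simp: component_def)

lemma saturated_restrict_iff: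
  assumes "saturated s K" "L \<subseteq> K"
  shows "saturated (restrict_structure K s) L \<longleftrightarrow> saturated s L"
  using assms unfolding saturated_def restrict_structure_def by auto blast+

text \<open>A saturated part \<open>L\<close> of the component \<open>?K\<close> either contains
  \<open>x\<close>, and then is everything by minimality, or misses \<open>x\<close>; in that case
  \<open>?K - L\<close> is saturated and contains \<open>x\<close>, and minimality makes
  \<open>L\<close> empty.\<close>

lemma connected_restrict_component:
  assumes s: "s \<in> structures U" and x: "x \<in> U"
  shows "connected_mgraph (part_graph (restrict_structure (component U x s) s))"
proof -
  let ?K = "component U x s"
  note K = component[OF s x]
  have "L = {} \<or> L = ?K" if L: "L \<subseteq> ?K" "saturated (restrict_structure ?K s) L" for L
  proof -
    have sat: "saturated s L" using saturated_restrict_iff[OF K(2) L(1)] L(2) by simp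
    show ?thesis
    proof (cases "x \<in> L")
      case True
      then show ?thesis using K(4)[of L] L(1) K(1) sat by blast
    next
      case False
      then have "?K \<subseteq> ?K - L"
        using K(1,3) by (intro K(4) saturated_Diff[OF K(2) sat]) auto
      then show ?thesis using L(1) by blast
    qed
  qed
  then show ?thesis
    using connected_part_graph_iff[OF restrict_structure[OF s K(1,2)]] K(3) by blast
qed

lemma saturated_join:
  assumes "s \<in> structures K" "s' \<in> structures L" "K \<inter> L = {}"
  shows "saturated (join s s') K"
  unfolding saturated_def
proof
  fix B assume "B \<in> fst (join s s') \<union> snd (join s s')"
  then have "B \<subseteq> K \<or> B \<subseteq> L"
    using block_subset[OF structuresD(1)[OF assms(1)]] block_subset[OF structuresD(2)[OF assms(1)]]
      block_subset[OF structuresD(1)[OF assms(2)]] block_subset[OF structuresD(2)[OF assms(2)]]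
    unfolding join_def by simp blast
  then show "B \<subseteq> K \<or> B \<inter> K = {}" using assms(3) by blast
qed

text \<open>\<open>K\<close> is saturated in the join, so it contains the component of
  \<open>x\<close>; as a nonempty saturated part of the connected \<open>s\<close>, the component is
  all of \<open>K\<close>.\<close>

lemma component_join:
  assumes s: "s \<in> structures K" "s' \<in> structures L" "K \<inter> L = {}"
    and conn: "connected_mgraph (part_graph s)" and x: "x \<in> K"
  shows "component (K \<union> L) x (join s s') = K"
proof
  have xU: "x \<in> K \<union> L" using x by simp
  note C = component[OF join_structures[OF s] xU]
  let ?C = "component (K \<union> L) x (join s s')"
  show sub: "?C \<subseteq> K" by (rule C(4)) (use x saturated_join[OF s] in auto)
  have "saturated s ?C"
    using saturated_restrict_iff[OF saturated_join[OF s] sub] C(2) restrict_join(1)[OF s] by simp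
  then have "?C = K" using conn sub C(3) connected_part_graph_iff[OF s(1)] by blast
  then show "K \<subseteq> ?C" by simp
qed

section \<open>Multiplicativity of the weight\<close>

lemma sum_PiE_Un:
  assumes "A \<inter> B = {}"
  shows "(\<Sum>c\<in>A \<union> B \<rightarrow>\<^sub>E F. f c) =
    (\<Sum>c\<in>A \<rightarrow>\<^sub>E F. \<Sum>d\<in>B \<rightarrow>\<^sub>E F. f (\<lambda>x. if x \<in> A then c x else d x))"
  unfolding sum.cartesian_product
proof (rule sum.reindex_bij_witness[where j = "\<lambda>c. (restrict c A, restrict c B)"
      and i = "\<lambda>(c, d) x. if x \<in> A then c x else d x"])
  fix c assume c: "c \<in> A \<union> B \<rightarrow>\<^sub>E F"
  then show eq: "(case (restrict c A, restrict c B) of (c, d) \<Rightarrow> \<lambda>x. if x \<in> A then c x else d x) = c"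
    by (auto simp: fun_eq_iff PiE_def extensional_def)
  show "(restrict c A, restrict c B) \<in> (A \<rightarrow>\<^sub>E F) \<times> (B \<rightarrow>\<^sub>E F)"
    using c by auto
  show "(case (restrict c A, restrict c B) of (c, d) \<Rightarrow> f (\<lambda>x. if x \<in> A then c x else d x)) = f c"
    using eq by simp
next
  fix p assume p: "p \<in> (A \<rightarrow>\<^sub>E F) \<times> (B \<rightarrow>\<^sub>E F)"
  obtain c d where cd: "p = (c, d)" "c \<in> A \<rightarrow>\<^sub>E F" "d \<in> B \<rightarrow>\<^sub>E F" using p by auto
  show "(case p of (c, d) \<Rightarrow> \<lambda>x. if x \<in> A then c x else d x) \<in> A \<union> B \<rightarrow>\<^sub>E F"
    using cd by (auto simp: PiE_def extensional_def)
  show "(restrict (case p of (c, d) \<Rightarrow> \<lambda>x. if x \<in> A then c x else d x) A,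
      restrict (case p of (c, d) \<Rightarrow> \<lambda>x. if x \<in> A then c x else d x) B) = p"
    using cd assms by (auto simp: fun_eq_iff PiE_def extensional_def restrict_def)
qed

lemma blocks_disjoint:
  assumes "s \<in> structures K" "s' \<in> structures L" "K \<inter> L = {}"
  shows "fst s \<inter> fst s' = {}"
proof (rule ccontr)
  assume "fst s \<inter> fst s' \<noteq> {}"
  then obtain B where B: "B \<in> fst s" "B \<in> fst s'" by blast
  then have "B \<subseteq> K \<inter> L" "B \<noteq> {}"
    using block_subset[OF structuresD(1)[OF assms(1)] B(1)]
      block_subset[OF structuresD(1)[OF assms(2)] B(2)] partition_onD3[OF structuresD(1)[OF assms(1)]]
    by blast+
  then show False using assms(3) by blast
qed

lemma cross_Un:
  assumes "\<Union>M \<subseteq> K" "\<Union>M' \<subseteq> L" "A \<subseteq> K" "A' \<subseteq> L" "K \<inter> L = {}"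
  shows "cross (M \<union> M') (A \<union> A') = cross M A \<union> cross M' A'"
proof -
  have "e \<subseteq> A \<union> A' \<longleftrightarrow> e \<subseteq> A" "e \<inter> (A \<union> A') = e \<inter> A" if "e \<in> M" for e
    using assms that by blast+
  moreover have "e \<subseteq> A \<union> A' \<longleftrightarrow> e \<subseteq> A'" "e \<inter> (A \<union> A') = e \<inter> A'" if "e \<in> M'" for e
    using assms that by blast+
  ultimately have "{e \<in> M \<union> M'. \<not> e \<subseteq> A \<union> A' \<and> e \<inter> (A \<union> A') \<noteq> {}} =
      {e \<in> M. \<not> e \<subseteq> A \<and> e \<inter> A \<noteq> {}} \<union> {e \<in> M'. \<not> e \<subseteq> A' \<and> e \<inter> A' \<noteq> {}}"
    by (intro set_eqI) (simp only: mem_Collect_eq Un_iff, metis)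
  then show ?thesis unfolding cross_def by simp
qed

text \<open>No edge runs between the two parts, so the even-white blocks of the join are the
  disjoint union of those of the parts: the exponents of \<open>t\<close> add, and the sum over
  pairs of colorings factors.\<close>

lemma W_poly_join:
  assumes s: "s \<in> structures K" "s' \<in> structures L" "K \<inter> L = {}" and fin: "finite K" "finite L"
  shows "W_poly (part_graph (join s s')) t = W_poly (part_graph s) t * W_poly (part_graph s') t"
proof -
  note D = structuresD[OF s(1)] and D' = structuresD[OF s(2)]
  define ew where "ew P M c = {B \<in> P. c B = 0 \<and> even (card (B \<inter> cross M (black P c)))}"
    for P M :: "'a set set" and c :: "'a set \<Rightarrow> nat"
  have U: "\<Union>(fst s) = K" "\<Union>(snd s) = K" "\<Union>(fst s') = L" "\<Union>(snd s') = L"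
    using D(1,2) D'(1,2) by (simp_all add: partition_on_def)
  note disj = blocks_disjoint[OF s]
  have finP: "finite (fst s)" "finite (fst s')"
    using D(1) D'(1) fin by (blast intro: finite_elements)+
  have ew: "ew (fst s \<union> fst s') (snd s \<union> snd s') (\<lambda>x. if x \<in> fst s then c x else d x) =
      ew (fst s) (snd s) c \<union> ew (fst s') (snd s') d" (is "ew ?P ?M ?c = _") for c d
  proof -
    have "black ?P ?c = black (fst s) c \<union> black (fst s') d"
      using disj unfolding black_def by auto
    moreover have sub: "black (fst s) c \<subseteq> K" "black (fst s') d \<subseteq> L"
      using U unfolding black_def by blast+
    ultimately have cr: "cross ?M (black ?P ?c) =
        cross (snd s) (black (fst s) c) \<union> cross (snd s') (black (fst s') d)"
      using cross_Un[OF _ _ sub s(3)] U by simp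
    have *: "cross (snd s) (black (fst s) c) \<subseteq> K" "cross (snd s') (black (fst s') d) \<subseteq> L"
      using U unfolding cross_def by blast+
    then have "B \<inter> cross ?M (black ?P ?c) = B \<inter> cross (snd s) (black (fst s) c)" if "B \<in> fst s" for B
      unfolding cr using that U s(3) by blast
    moreover have "B \<inter> cross ?M (black ?P ?c) = B \<inter> cross (snd s') (black (fst s') d)" if "B \<in> fst s'" for B
      unfolding cr using that U s(3) * by blast
    moreover have "B \<notin> fst s" if "B \<in> fst s'" for B using that disj by blast
    ultimately have "B \<in> ew ?P ?M ?c \<longleftrightarrow> B \<in> ew (fst s) (snd s) c \<union> ew (fst s') (snd s') d" for B
      unfolding ew_def by (cases "B \<in> fst s"; cases "B \<in> fst s'") simp_all
    then show ?thesis by blast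
  qed
  have card: "card (ew (fst s) (snd s) c \<union> ew (fst s') (snd s') d) =
      card (ew (fst s) (snd s) c) + card (ew (fst s') (snd s') d)" for c d
    using disj finP by (intro card_Un_disjoint) (auto simp: ew_def)
  have "W_poly (part_graph (join s s')) t =
      (\<Sum>c\<in>fst s \<union> fst s' \<rightarrow>\<^sub>E {0, 1}. t ^ card (ew (fst s \<union> fst s') (snd s \<union> snd s') c))"
    unfolding W_poly_part_graph[OF join_structures[OF s]] ew_def by (simp add: join_def)
  also have "\<dots> = W_poly (part_graph s) t * W_poly (part_graph s') t"
    unfolding sum_PiE_Un[OF disj] ew card power_add
    unfolding ew_def W_poly_part_graph[OF s(1)] W_poly_part_graph[OF s(2)] sum_product ..
  finally show ?thesis .
qed

lemma weight_join:
  assumes s: "s \<in> structures K" "s' \<in> structures L" "K \<inter> L = {}" and fin: "finite K" "finite L"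
  shows "weight (join s s') = weight s * weight s'"
proof -
  note D = structuresD[OF s(1)] and D' = structuresD[OF s(2)]
  have "finite (fst s)" "finite (fst s')"
    using D(1) D'(1) fin by (blast intro: finite_elements)+
  then have "(\<Prod>B\<in>fst s \<union> fst s'. xi (card B)) = (\<Prod>B\<in>fst s. xi (card B)) * (\<Prod>B\<in>fst s'. xi (card B))"
    using blocks_disjoint[OF s] by (intro prod.union_disjoint)
  then have "(\<Prod>B\<in>fst (join s s'). xi (card B)) =
      (\<Prod>B\<in>fst s. xi (card B)) * (\<Prod>B\<in>fst s'. xi (card B))"
    by (simp add: join_def)
  then show ?thesis by (simp add: weight_def W_poly_join[OF assms] mult_ac)
qed

text \<open>The marked end \<open>x\<close> selects one component \<open>K\<close>, so every
  structure arises exactly once from \<open>K\<close>, a connected structure on \<open>K\<close> and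
  an arbitrary structure on the remaining ends. Marking an end is the combinatorial meaning of the
  derivative in A' = C' A.\<close>

lemma total_weight_split:
  assumes fin: "finite U" and x: "x \<in> U"
  shows "total_weight U = (\<Sum>K | K \<subseteq> U \<and> x \<in> K. connected_weight K * total_weight (U - K))"
proof -
  let ?C = "\<lambda>K. {s \<in> structures K. connected_mgraph (part_graph s)}"
  let ?I = "{K. K \<subseteq> U \<and> x \<in> K}"
  have finK: "finite K" if "K \<in> ?I" for K using that fin finite_subset by blast
  have "(\<Sum>K\<in>?I. connected_weight K * total_weight (U - K)) =
      (\<Sum>K\<in>?I. \<Sum>(s, s')\<in>?C K \<times> structures (U - K). weight s * weight s')"
    by (simp add: connected_weight_def total_weight_def sum_product sum.cartesian_product)
  also have "\<dots> = (\<Sum>(K, s, s')\<in>(SIGMA K:?I. ?C K \<times> structures (U - K)). weight s * weight s')"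
  proof (rule sum.Sigma)
    show "finite ?I" using fin by simp
    show "\<forall>K\<in>?I. finite (?C K \<times> structures (U - K))"
      using finite_structures[OF finK] finite_structures[of "U - _"] fin by (intro ballI finite_cartesian_product) simp_all
  qed
  also have "\<dots> = (\<Sum>s\<in>structures U. weight s)"
  proof (rule sum.reindex_bij_witness[where j = "\<lambda>(K, s, s'). join s s'"
        and i = "\<lambda>s. (component U x s, restrict_structure (component U x s) s,
          restrict_structure (U - component U x s) s)"])
    fix p assume p: "p \<in> (SIGMA K:?I. ?C K \<times> structures (U - K))"
    obtain K s s' where ps: "p = (K, s, s')" by (cases p)
    have K: "K \<subseteq> U" "x \<in> K" "K \<union> (U - K) = U" and s: "s \<in> structures K" "s' \<in> structures (U - K)"
      "K \<inter> (U - K) = {}" and conn: "connected_mgraph (part_graph s)"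
      using p unfolding ps by blast+
    have comp: "component U x (join s s') = K"
      using component_join[OF s conn K(2)] K(3) by simp
    show "(case (case p of (K, s, s') \<Rightarrow> join s s') of s \<Rightarrow> (component U x s,
        restrict_structure (component U x s) s, restrict_structure (U - component U x s) s)) = p"
      by (simp add: ps comp restrict_join[OF s])
    show "(case p of (K, s, s') \<Rightarrow> join s s') \<in> structures U"
      using join_structures[OF s] K(3) by (simp add: ps)
    show "weight (case p of (K, s, s') \<Rightarrow> join s s') = (case p of (K, s, s') \<Rightarrow> weight s * weight s')"
      using weight_join[OF s] fin finite_subset[OF K(1)] by (simp add: ps)
  next
    fix s assume s: "s \<in> structures U"
    note K = component[OF s x]
    have "saturated s (U - component U x s)"
      by (rule saturated_Diff[OF saturated_whole[OF s] K(2)])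
    then have "restrict_structure (U - component U x s) s \<in> structures (U - component U x s)"
      by (intro restrict_structure[OF s]) auto
    then show "(component U x s, restrict_structure (component U x s) s,
        restrict_structure (U - component U x s) s) \<in> (SIGMA K:?I. ?C K \<times> structures (U - K))"
      using K connected_restrict_component[OF s x] restrict_structure[OF s K(1,2)] by simp
    show "(case (component U x s, restrict_structure (component U x s) s,
        restrict_structure (U - component U x s) s) of (K, s, s') \<Rightarrow> join s s') = s"
      using join_restrict[OF s K(2)] by simp
  qed
  finally show ?thesis by (simp add: total_weight_def)
qed


section \<open>The functional as a sum over matchings\<close>

lemma bw_eq_sum:
  assumes "finite A" "Poly_Mapping.keys P \<subseteq> A"
  shows "bw P = (\<Sum>m\<in>A. Poly_Mapping.lookup P m * mconst (bw_monomial m))"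
  unfolding bw_def using assms
  by (intro sum.mono_neutral_left) (auto simp: in_keys_iff)

lemma bw_add: "bw (P + Q) = bw P + bw Q"
proof -
  let ?A = "Poly_Mapping.keys P \<union> Poly_Mapping.keys Q"
  have "finite ?A" "Poly_Mapping.keys (P + Q) \<subseteq> ?A" by (simp_all add: keys_add)
  then show ?thesis
    by (simp add: bw_eq_sum[of ?A P] bw_eq_sum[of ?A Q] bw_eq_sum[of ?A "P + Q"]
        lookup_add distrib_right sum.distrib)
qed

lemma bw_zero: "bw 0 = 0"
  by (simp add: bw_def)

lemma bw_sum: "bw (\<Sum>x\<in>A. f x) = (\<Sum>x\<in>A. bw (f x))"
  by (induction A rule: infinite_finite_induct) (simp_all add: bw_zero bw_add)

lemma bw_mconst_mult: "bw (mconst a * P) = a * bw P"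
proof -
  have l: "Poly_Mapping.lookup (mconst a * P) m = a * Poly_Mapping.lookup P m" for m
    by (simp add: mconst_def flip: mult_map_scale_conv_mult)
      (simp add: Poly_Mapping.map.rep_eq when_def)
  then have "Poly_Mapping.keys (mconst a * P) \<subseteq> Poly_Mapping.keys P"
    by (auto simp: in_keys_iff)
  then show ?thesis
    by (simp add: bw_eq_sum[of "Poly_Mapping.keys P"] l sum_distrib_left mult.assoc)
qed

lemma bw_single: "bw (Poly_Mapping.single m 1) = mconst (bw_monomial m)"
  by (simp add: bw_def)

lemma mconst_one: "mconst 1 = 1"
  by (simp add: mconst_def)

lemma mconst_mult: "mconst (a * b) = mconst a * mconst b"
  by (simp add: mconst_def mult_single)

lemma mconst_add: "mconst (a + b) = mconst a + mconst b"
  by (simp add: mconst_def single_add)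

lemma mconst_of_nat: "mconst (of_nat n) = of_nat n"
  by (simp add: mconst_def)

lemma mconst_prod: "mconst (\<Prod>x\<in>A. f x) = (\<Prod>x\<in>A. mconst (f x))"
  by (induction A rule: infinite_finite_induct) (simp_all add: mconst_one mconst_mult)

section \<open>Wick's formula for monomials\<close>

lemma prod_mvar:
  "(\<Prod>h\<in>U. mvar (\<tau> h)) = Poly_Mapping.single (\<Sum>h\<in>U. Poly_Mapping.single (\<tau> h) 1) 1"
  by (induction U rule: infinite_finite_induct) (simp_all add: mvar_def mult_single)

lemma lookup_sum_single:
  "finite U \<Longrightarrow> Poly_Mapping.lookup (\<Sum>h\<in>U. Poly_Mapping.single (\<tau> h) (1::nat)) v = card {h \<in> U. \<tau> h = v}"
  by (simp add: lookup_sum lookup_single when_def flip: sum.inter_filter)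

lemma gauss_moment_0: "gauss_moment 0 = 1"
  by (simp add: gauss_moment_def)

lemma gauss_moment_1: "gauss_moment (Suc 0) = 0"
  by (simp add: gauss_moment_def)

text \<open>The recurrence for perfect matchings: a fixed one of n + 2 points has n + 1 possible
  partners, and n points remain.\<close>

lemma gauss_moment_Suc_Suc: "gauss_moment (Suc (Suc n)) = of_nat (Suc n) * gauss_moment n"
proof (cases "even n")
  case True
  then obtain k where n: "n = 2 * k" by (elim evenE)
  have "gauss_moment (Suc (Suc n)) = (of_nat (2 * k + 2) * (of_nat (2 * k + 1) * fact (2 * k)))
      / (2 * 2 ^ k * (of_nat (Suc k) * fact k))"
    by (simp add: gauss_moment_def n)
  also have "of_nat (2 * k + 2) = (2 * of_nat (Suc k) :: rat)" by simp
  also have "(2 * of_nat (Suc k) * (of_nat (2 * k + 1) * fact (2 * k))) / (2 * 2 ^ k * (of_nat (Suc k) * fact k))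
      = of_nat (2 * k + 1) * (fact (2 * k) / (2 ^ k * fact k :: rat))"
    by (simp add: divide_simps del: of_nat_Suc)
  finally show ?thesis by (simp add: gauss_moment_def n)
qed (simp add: gauss_moment_def)

lemma matchings_empty: "matchings {} = {{}}"
  by (auto simp: matchings_def partition_on_empty)

lemma matchings_insert:
  assumes "h \<in> U" "k \<in> U" "h \<noteq> k" "M \<in> matchings (U - {h, k})"
  shows "insert {h, k} M \<in> matchings U" "{h, k} \<notin> M"
proof -
  have M: "partition_on (U - {h, k}) M" using assms(4) by (simp add: matchings_def)
  have "\<Union>M = U - {h, k}" using M by (simp add: partition_on_def)
  then have "disjnt {h, k} (\<Union>M)" by (simp add: disjnt_def)
  then have "partition_on U (insert {h, k} M)"
    using partition_on_insert[of "{h, k}" M U] M assms by simp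
  then show "insert {h, k} M \<in> matchings U"
    using assms by (simp add: matchings_def)
  show "{h, k} \<notin> M" using \<open>\<Union>M = U - {h, k}\<close> by blast
qed

lemma matchings_remove:
  assumes "M \<in> matchings U" "h \<in> U"
  obtains k where "k \<in> U - {h}" "{h, k} \<in> M" "M - {{h, k}} \<in> matchings (U - {h, k})"
proof -
  have M: "partition_on U M" "\<And>e. e \<in> M \<Longrightarrow> card e = 2" using assms by (auto simp: matchings_def)
  obtain e where e: "e \<in> M" "h \<in> e" using assms(2) partition_onD1[OF M(1)] by blast
  obtain k where k: "e = {h, k}" "h \<noteq> k" using M(2)[OF e(1)] e(2) by (auto simp: card_2_iff)
  have U: "k \<in> U" using block_subset[OF M(1) e(1)] k by simp
  have "\<And>d. d \<in> M - {e} \<Longrightarrow> d \<inter> e = {}"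
    using M(1) e(1) by (auto simp: partition_on_def disjoint_def)
  then have "disjnt e (\<Union>(M - {e}))" unfolding disjnt_def by blast
  moreover have "insert e (M - {e}) = M" using e(1) by blast
  ultimately have "partition_on (U - e) (M - {e})"
    using partition_on_insert[of e "M - {e}" U] M(1) by simp
  then have "M - {{h, k}} \<in> matchings (U - {h, k})"
    using M(2) k(1) by (simp add: matchings_def)
  then show thesis using that[of k] U k e(1) by simp
qed

text \<open>Remove the edge at \<open>h\<close>, indexed by its other end \<open>k\<close>. A
  condition imposed on each edge separately passes to the remaining matching.\<close>

lemma card_matchings_split:
  assumes "finite U" "h \<in> U"
  shows "card {M \<in> matchings U. \<forall>e\<in>M. Q e} =
    (\<Sum>k | k \<in> U - {h} \<and> Q {h, k}. card {M \<in> matchings (U - {h, k}). \<forall>e\<in>M. Q e})"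
proof -
  let ?K = "{k. k \<in> U - {h} \<and> Q {h, k}}"
  let ?N = "\<lambda>k. {M \<in> matchings (U - {h, k}). \<forall>e\<in>M. Q e}"
  have "bij_betw (\<lambda>(k, M). insert {h, k} M) (SIGMA k:?K. ?N k) {M \<in> matchings U. \<forall>e\<in>M. Q e}"
  proof (rule bij_betw_imageI)
    show "inj_on (\<lambda>(k, M). insert {h, k} M) (SIGMA k:?K. ?N k)"
    proof (rule inj_onI)
      fix p p' assume p: "p \<in> (SIGMA k:?K. ?N k)" "p' \<in> (SIGMA k:?K. ?N k)"
        and eq: "(case p of (k, M) \<Rightarrow> insert {h, k} M) = (case p' of (k, M) \<Rightarrow> insert {h, k} M)"
      obtain k M k' M' where ps: "p = (k, M)" "p' = (k', M')" by (cases p; cases p')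
      have k: "k \<in> U" "h \<noteq> k" "k' \<in> U" "h \<noteq> k'" and M: "M \<in> matchings (U - {h, k})" "M' \<in> matchings (U - {h, k'})"
        using p ps by auto
      have eq: "insert {h, k} M = insert {h, k'} M'" using eq ps by simp
      have "partition_on U (insert {h, k} M)"
        using matchings_insert(1)[OF assms(2) k(1,2) M(1)] by (simp add: matchings_def)
      then have "{h, k} = {h, k'}"
        by (rule partition_on_block_unique[of _ _ _ _ h]) (use eq in auto)
      then have "k = k'" using k by (metis doubleton_eq_iff)
      moreover have "M = M'"
        using eq matchings_insert(2)[OF assms(2) k(1,2) M(1)] matchings_insert(2)[OF assms(2) k(3,4) M(2)]
          \<open>k = k'\<close> by (metis Diff_insert_absorb)
      ultimately show "p = p'" using ps by simp
    qed
    show "(\<lambda>(k, M). insert {h, k} M) ` (SIGMA k:?K. ?N k) = {M \<in> matchings U. \<forall>e\<in>M. Q e}"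
    proof (intro subset_antisym subsetI)
      fix M assume "M \<in> (\<lambda>(k, M). insert {h, k} M) ` (SIGMA k:?K. ?N k)"
      then show "M \<in> {M \<in> matchings U. \<forall>e\<in>M. Q e}"
        using matchings_insert(1)[OF assms(2)] by auto
    next
      fix M assume M: "M \<in> {M \<in> matchings U. \<forall>e\<in>M. Q e}"
      then obtain k where k: "k \<in> U - {h}" "{h, k} \<in> M" "M - {{h, k}} \<in> matchings (U - {h, k})"
        using matchings_remove[OF _ assms(2)] by blast
      then have "(k, M - {{h, k}}) \<in> (SIGMA k:?K. ?N k)" using M by simp
      moreover have "M = (\<lambda>(k, M). insert {h, k} M) (k, M - {{h, k}})" using k(2) by auto
      ultimately show "M \<in> (\<lambda>(k, M). insert {h, k} M) ` (SIGMA k:?K. ?N k)" by (rule rev_image_eqI)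
    qed
  qed
  then have "card {M \<in> matchings U. \<forall>e\<in>M. Q e} = card (SIGMA k:?K. ?N k)"
    by (simp add: bij_betw_same_card)
  also have "\<dots> = (\<Sum>k\<in>?K. card (?N k))"
    using assms(1) finite_matchings[of "U - _"] by (intro card_SigmaI) simp_all
  finally show ?thesis .
qed

text \<open>For two-element \<open>e\<close> these are the pairs of variables with nonzero
  expectation, namely bb, ww and yz, each of expectation 1.\<close>

definition contractible :: "('h \<Rightarrow> bwyz_var) \<Rightarrow> 'h set \<Rightarrow> bool" where
  "contractible \<tau> e \<longleftrightarrow> \<tau> ` e \<in> {{Var_b}, {Var_w}, {Var_y, Var_z}}"

definition wick_count :: "nat \<Rightarrow> nat \<Rightarrow> nat \<Rightarrow> nat \<Rightarrow> rat" where
  "wick_count nb nw ny nz =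
    gauss_moment nb * gauss_moment nw * (if ny = nz then fact ny else 0)"

text \<open>This and the next three facts are the recurrences for removing an end of the given
  variable together with its partner. Truncated subtraction is harmless: if there is no partner,
  both sides vanish.\<close>

lemma wick_count_b:
  "nb > 0 \<Longrightarrow> of_nat (nb - 1) * wick_count (nb - 1 - 1) nw ny nz = wick_count nb nw ny nz"
  by (cases nb; cases "nb - 1") (simp_all add: wick_count_def gauss_moment_1 gauss_moment_Suc_Suc mult.assoc)

lemma wick_count_w:
  "nw > 0 \<Longrightarrow> of_nat (nw - 1) * wick_count nb (nw - 1 - 1) ny nz = wick_count nb nw ny nz"
  by (cases nw; cases "nw - 1") (simp_all add: wick_count_def gauss_moment_1 gauss_moment_Suc_Suc)

lemma wick_count_y:
  "ny > 0 \<Longrightarrow> of_nat nz * wick_count nb nw (ny - 1) (nz - 1) = wick_count nb nw ny nz"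
  by (cases ny; cases nz) (simp_all add: wick_count_def)

lemma wick_count_z:
  "nz > 0 \<Longrightarrow> of_nat ny * wick_count nb nw (ny - 1) (nz - 1) = wick_count nb nw ny nz"
  by (cases ny; cases nz) (auto simp: wick_count_def)

text \<open>Induction removes an end \<open>h\<close> and its partner. The variable at
  \<open>h\<close> dictates that of the partner, so all choices of the partner leave the same four
  exponents, and the recurrences of \<open>wick_count\<close> apply.\<close>

lemma card_contractible_matchings:
  assumes "finite U"
  shows "of_nat (card {M \<in> matchings U. \<forall>e\<in>M. contractible \<tau> e}) =
    wick_count (card {h \<in> U. \<tau> h = Var_b}) (card {h \<in> U. \<tau> h = Var_w})
      (card {h \<in> U. \<tau> h = Var_y}) (card {h \<in> U. \<tau> h = Var_z})"
  using assms
proof (induction U rule: finite_psubset_induct)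
  case (psubset U)
  let ?n = "\<lambda>v. card {h \<in> U. \<tau> h = v}"
  show ?case
  proof (cases "U = {}")
    case True
    have "{M \<in> {{}}. \<forall>e\<in>M. contractible \<tau> e} = {{}}" by auto
    then show ?thesis by (simp add: True matchings_empty wick_count_def gauss_moment_0)
  next
    case False
    then obtain h where h: "h \<in> U" by blast
    \<comment> \<open>The only variable that has nonzero expectation together with that of
      \<open>h\<close>.\<close>
    define mate where "mate = (case \<tau> h of Var_b \<Rightarrow> Var_b | Var_w \<Rightarrow> Var_w | Var_y \<Rightarrow> Var_z | Var_z \<Rightarrow> Var_y)"
    have mate: "contractible \<tau> {h, k} \<longleftrightarrow> \<tau> k = mate" for k
      unfolding contractible_def mate_def by (cases "\<tau> h"; cases "\<tau> k") (auto simp: doubleton_eq_iff)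
    let ?K = "{k. k \<in> U - {h} \<and> contractible \<tau> {h, k}}"
    \<comment> \<open>The exponents after the removal. For b and w, \<open>\<tau> h\<close> and
      \<open>mate\<close> coincide and the same exponent drops by 2; for y and z, two exponents drop
      by 1.\<close>
    define m where "m v = ?n v - (if v = \<tau> h then 1 else 0) - (if v = mate then 1 else 0)" for v
    have rest: "card {u \<in> U - {h, k}. \<tau> u = v} = m v" if "k \<in> ?K" for k v
    proof -
      have k: "k \<in> U" "h \<noteq> k" "\<tau> k = mate" using that mate by auto
      have "{u \<in> U - {h, k}. \<tau> u = v} = {u \<in> U. \<tau> u = v} - {h} - {k}" by auto
      then show ?thesis
        using k h psubset.hyps by (simp add: m_def card_Diff_singleton_if)
    qed
    have "card {M \<in> matchings U. \<forall>e\<in>M. contractible \<tau> e} =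
        (\<Sum>k\<in>?K. card {M \<in> matchings (U - {h, k}). \<forall>e\<in>M. contractible \<tau> e})"
      by (rule card_matchings_split[OF psubset.hyps h])
    then have "of_nat (card {M \<in> matchings U. \<forall>e\<in>M. contractible \<tau> e}) =
        (\<Sum>k\<in>?K. (of_nat (card {M \<in> matchings (U - {h, k}). \<forall>e\<in>M. contractible \<tau> e}) :: rat))"
      by simp
    also have "\<dots> = (\<Sum>k\<in>?K. wick_count (m Var_b) (m Var_w) (m Var_y) (m Var_z))"
    proof (intro sum.cong refl)
      fix k assume k: "k \<in> ?K"
      have "U - {h, k} \<subset> U" using h by blast
      from psubset.IH[OF this] show "of_nat (card {M \<in> matchings (U - {h, k}). \<forall>e\<in>M. contractible \<tau> e}) =
          wick_count (m Var_b) (m Var_w) (m Var_y) (m Var_z)"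
        by (simp only: rest[OF k])
    qed
    also have "\<dots> = of_nat (card ?K) * wick_count (m Var_b) (m Var_w) (m Var_y) (m Var_z)"
      by simp
    also have "card ?K = ?n mate - (if mate = \<tau> h then 1 else 0)"
    proof -
      have "?K = {k \<in> U. \<tau> k = mate} - {h}" using mate by auto
      then show ?thesis using h by (auto simp: card_Diff_singleton_if)
    qed
    also have "of_nat (?n mate - (if mate = \<tau> h then 1 else 0)) * wick_count (m Var_b) (m Var_w) (m Var_y) (m Var_z)
        = wick_count (?n Var_b) (?n Var_w) (?n Var_y) (?n Var_z)"
    proof -
      have pos: "?n (\<tau> h) > 0" using h psubset.hyps by (auto simp: card_gt_0_iff)
      show ?thesis
      proof (cases "\<tau> h")
        case Var_b
        then show ?thesis using wick_count_b pos by (simp add: m_def mate_def)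
      next
        case Var_w
        then show ?thesis using wick_count_w pos by (simp add: m_def mate_def)
      next
        case Var_y
        then show ?thesis using wick_count_y pos by (simp add: m_def mate_def)
      next
        case Var_z
        then show ?thesis using wick_count_z pos by (simp add: m_def mate_def)
      qed
    qed
    finally show ?thesis .
  qed
qed

text \<open>Wick's formula: the expectation of a product is the sum over matchings of the products
  of pair expectations, each of which is 0 or 1.\<close>

lemma bw_prod_mvar:
  assumes "finite U"
  shows "bw (\<Prod>h\<in>U. mvar (\<tau> h)) = of_nat (card {M \<in> matchings U. \<forall>e\<in>M. contractible \<tau> e})"
  unfolding prod_mvar bw_single bw_monomial_def lookup_sum_single[OF assms]
  unfolding wick_count_def[symmetric] card_contractible_matchings[OF assms, symmetric] mconst_of_nat ..

section \<open>Products of the polynomials \<open>F_poly\<close> as sums over matchings\<close>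

lemma sum_Pow_card:
  fixes f :: "nat \<Rightarrow> 'a::comm_semiring_1"
  assumes "finite A"
  shows "(\<Sum>Y\<in>Pow A. f (card Y)) = (\<Sum>i=0..card A. of_nat (card A choose i) * f i)"
proof -
  have "(\<Sum>Y\<in>Pow A. f (card Y)) = (\<Sum>i=0..card A. \<Sum>Y\<in>{Y \<in> Pow A. card Y = i}. f (card Y))"
    by (rule sum.group[symmetric]) (use assms in \<open>auto simp: card_mono\<close>)
  also have "\<dots> = (\<Sum>i=0..card A. of_nat (card A choose i) * f i)"
    using n_subsets[OF assms] by (intro sum.cong refl) (simp add: Pow_def)
  finally show ?thesis .
qed

text \<open>Here \<open>bl\<close> is the color of the block containing the end and
  \<open>cr\<close> the declaration that its edge is bichromatic. Contracting y only with z, and b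
  and w only with themselves, enforces the declarations.\<close>

definition end_var :: "bool \<Rightarrow> bool \<Rightarrow> bwyz_var" where
  "end_var bl cr = (if bl then if cr then Var_y else Var_b else if cr then Var_z else Var_w)"

definition parity_factor :: "nat \<Rightarrow> nat \<Rightarrow> coeff_ring" where
  "parity_factor c n = (if c = 1 then 1 else p_par n)"

text \<open>The binomial coefficients count the sets \<open>Y\<close> of ends declared bichromatic.
  Color 1 gives the power of b + y by the binomial theorem, color 0 the sum weighted by
  \<open>p_par\<close>.\<close>

lemma F_poly_eq_sum:
  assumes "finite B"
  shows "F_poly (card B) = (\<Sum>c\<in>{0, 1}. \<Sum>Y\<in>Pow B.
    mconst (parity_factor c (card Y)) * (\<Prod>h\<in>B. mvar (end_var (c = 1) (h \<in> Y))))"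
proof -
  have prod: "(\<Prod>h\<in>B. mvar (end_var bl (h \<in> Y)) :: bwyz_ring) =
      mvar (end_var bl True) ^ card Y * mvar (end_var bl False) ^ (card B - card Y)" if "Y \<in> Pow B" for bl Y
  proof -
    have "(\<Prod>h\<in>B. mvar (end_var bl (h \<in> Y)) :: bwyz_ring) =
        (\<Prod>h\<in>B. if h \<in> Y then mvar (end_var bl True) else mvar (end_var bl False))"
      by (intro prod.cong refl) auto
    also have "\<dots> = mvar (end_var bl True) ^ card (B \<inter> Y) * mvar (end_var bl False) ^ card (B \<inter> - Y)"
      using assms by (simp add: prod.If_cases)
    also have "B \<inter> Y = Y" using that by auto
    also have "B \<inter> - Y = B - Y" by auto
    also have "card (B - Y) = card B - card Y"
      using that assms by (intro card_Diff_subset) (auto intro: finite_subset)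
    finally show ?thesis .
  qed
  have "(\<Sum>c\<in>{0, 1::nat}. \<Sum>Y\<in>Pow B.
      mconst (parity_factor c (card Y)) * (\<Prod>h\<in>B. mvar (end_var (c = 1) (h \<in> Y)))) =
    (\<Sum>c\<in>{0, 1::nat}. \<Sum>Y\<in>Pow B. (\<lambda>i. mconst (parity_factor c i) *
      (mvar (end_var (c = 1) True) ^ i * mvar (end_var (c = 1) False) ^ (card B - i))) (card Y))"
    using prod by (intro sum.cong refl) simp
  also have "\<dots> = (\<Sum>c\<in>{0, 1::nat}. \<Sum>i=0..card B. of_nat (card B choose i) * (mconst (parity_factor c i) *
      (mvar (end_var (c = 1) True) ^ i * mvar (end_var (c = 1) False) ^ (card B - i))))"
  proof (intro sum.cong refl)
    fix c :: nat
    let ?f = "\<lambda>i. mconst (parity_factor c i) * (mvar (end_var (c = 1) True) ^ i *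
      mvar (end_var (c = 1) False) ^ (card B - i)) :: bwyz_ring"
    show "(\<Sum>Y\<in>Pow B. ?f (card Y)) = (\<Sum>i=0..card B. of_nat (card B choose i) * ?f i)"
      by (rule sum_Pow_card[OF assms])
  qed
  also have "\<dots> = F_poly (card B)"
    by (simp add: F_poly_def parity_factor_def end_var_def mconst_one binomial_ring atLeast0AtMost
        add.commute[of "mvar Var_b"] mult_ac)
  finally show ?thesis by simp
qed

lemma cross_edge_iff:
  assumes "M \<in> matchings U" "{h, k} \<in> M"
  shows "h \<in> cross M A \<longleftrightarrow> (h \<in> A) \<noteq> (k \<in> A)"
proof -
  have M: "partition_on U M" using assms by (simp add: matchings_def)
  have "e = {h, k}" if "e \<in> M" "h \<in> e" for e
    using partition_on_block_unique[OF M that(1) assms(2) that(2)] by simp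
  then have "h \<in> cross M A \<longleftrightarrow> \<not> {h, k} \<subseteq> A \<and> {h, k} \<inter> A \<noteq> {}"
    unfolding cross_def using assms(2) by blast
  then show ?thesis by auto
qed

lemma contractible_pair:
  assumes "\<tau> h = end_var a x" "\<tau> k = end_var b y"
  shows "contractible \<tau> {h, k} \<longleftrightarrow> (x \<longleftrightarrow> a \<noteq> b) \<and> (y \<longleftrightarrow> b \<noteq> a)"
  using assms
  by (cases a; cases b; cases x; cases y) (simp_all add: contractible_def end_var_def doubleton_eq_iff)

text \<open>\<open>A\<close> is the set of black ends and \<open>X\<close> the set of ends declared
  bichromatic. An edge is contractible exactly when the declaration is correct at both of its ends,
  so a matching and a coloring force \<open>X\<close>.\<close>

lemma contractible_iff_cross:
  assumes M: "M \<in> matchings U" and X: "X \<subseteq> U"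
    and \<tau>: "\<And>h. h \<in> U \<Longrightarrow> \<tau> h = end_var (h \<in> A) (h \<in> X)"
  shows "(\<forall>e\<in>M. contractible \<tau> e) \<longleftrightarrow> X = cross M A"
proof -
  have part: "partition_on U M" and two: "\<And>e. e \<in> M \<Longrightarrow> card e = 2" using M by (auto simp: matchings_def)
  have edge: "contractible \<tau> {h, k} \<longleftrightarrow> (h \<in> X \<longleftrightarrow> h \<in> cross M A) \<and> (k \<in> X \<longleftrightarrow> k \<in> cross M A)"
    if e: "{h, k} \<in> M" for h k
  proof -
    have "h \<in> U" "k \<in> U" using block_subset[OF part e] by auto
    from contractible_pair[of \<tau> h _ _ k, OF \<tau>[OF this(1)] \<tau>[OF this(2)]]
    have "contractible \<tau> {h, k} \<longleftrightarrow>
      (h \<in> X \<longleftrightarrow> (h \<in> A) \<noteq> (k \<in> A)) \<and> (k \<in> X \<longleftrightarrow> (k \<in> A) \<noteq> (h \<in> A))" .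
    moreover have "k \<in> cross M A \<longleftrightarrow> (k \<in> A) \<noteq> (h \<in> A)"
      using cross_edge_iff[OF M, of k h] e by (simp add: insert_commute)
    ultimately show ?thesis
      using cross_edge_iff[OF M e] by simp
  qed
  have "(\<forall>e\<in>M. contractible \<tau> e) \<longleftrightarrow> (\<forall>e\<in>M. \<forall>h\<in>e. h \<in> X \<longleftrightarrow> h \<in> cross M A)"
  proof (intro ball_cong refl)
    fix e assume e: "e \<in> M"
    obtain h k where "e = {h, k}" using two[OF e] by (auto simp: card_2_iff)
    then show "contractible \<tau> e \<longleftrightarrow> (\<forall>h\<in>e. h \<in> X \<longleftrightarrow> h \<in> cross M A)"
      using edge e by simp
  qed
  also have "\<dots> \<longleftrightarrow> (\<forall>h\<in>U. h \<in> X \<longleftrightarrow> h \<in> cross M A)"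
    using partition_onD1[OF part] by blast
  also have "\<dots> \<longleftrightarrow> X = cross M A"
  proof -
    have "cross M A \<subseteq> U" using partition_onD1[OF part] unfolding cross_def by blast
    then show ?thesis using X by blast
  qed
  finally show ?thesis .
qed

text \<open>Expand each factor into a color and a declared subset of its block, apply Wick's
  formula, and exchange sums. For a fixed coloring \<open>c\<close> and matching \<open>M\<close>,
  only one family \<open>g\<close> of declared subsets survives, and its parity factors multiply to
  the summand of \<open>W_poly\<close> at \<open>c\<close>.\<close>

lemma bw_prod_F_poly:
  assumes fin: "finite U" and P: "partition_on U P"
  shows "bw (\<Prod>B\<in>P. F_poly (card B)) = (\<Sum>M\<in>matchings U. W_poly (part_graph (P, M)) t_ind)"
proof -
  have finP: "finite P" using P fin by (rule finite_elements[rotated])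
  have finB: "finite B" if "B \<in> P" for B using block_subset[OF P that] fin finite_subset by blast
  define block where "block h = (THE B. B \<in> P \<and> h \<in> B)" for h
  have block: "block h = B" if "B \<in> P" "h \<in> B" for h B
    unfolding block_def using that partition_on_block_unique[OF P] by (intro the_equality) blast+
  define \<tau> where "\<tau> c g h = end_var (c (block h) = (1::nat)) (h \<in> g (block h))"
    for c and g :: "'a set \<Rightarrow> 'a set" and h
  let ?C = "P \<rightarrow>\<^sub>E {0, 1::nat}" and ?G = "PiE P Pow"
  let ?q = "\<lambda>c g. \<Prod>B\<in>P. parity_factor (c B) (card (g B :: 'a set))"
  have "(\<Prod>B\<in>P. F_poly (card B)) = (\<Prod>B\<in>P. \<Sum>c\<in>{0, 1}. \<Sum>Y\<in>Pow B.
      mconst (parity_factor c (card Y)) * (\<Prod>h\<in>B. mvar (end_var (c = 1) (h \<in> Y))))"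
    by (intro prod.cong refl F_poly_eq_sum finB)
  also have "\<dots> = (\<Sum>c\<in>?C. \<Prod>B\<in>P. \<Sum>Y\<in>Pow B.
      mconst (parity_factor (c B) (card Y)) * (\<Prod>h\<in>B. mvar (end_var (c B = 1) (h \<in> Y))))"
    by (rule prod_sum_PiE) (use finP in auto)
  also have "\<dots> = (\<Sum>c\<in>?C. \<Sum>g\<in>?G. \<Prod>B\<in>P.
      mconst (parity_factor (c B) (card (g B))) * (\<Prod>h\<in>B. mvar (end_var (c B = 1) (h \<in> g B))))"
    by (intro sum.cong refl prod_sum_PiE) (use finP finB in auto)
  also have "\<dots> = (\<Sum>c\<in>?C. \<Sum>g\<in>?G. mconst (?q c g) * (\<Prod>h\<in>U. mvar (\<tau> c g h)))"
  proof (intro sum.cong refl)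
    fix c g
    have "(\<Prod>B\<in>P. \<Prod>h\<in>B. mvar (end_var (c B = (1::nat)) (h \<in> g B))) =
        (\<Prod>B\<in>P. \<Prod>h\<in>B. mvar (\<tau> c g h) :: bwyz_ring)"
      by (intro prod.cong refl) (simp add: \<tau>_def block)
    also have "\<dots> = (\<Prod>h\<in>\<Union>P. mvar (\<tau> c g h))"
    proof (rule prod.Union_disjoint[unfolded o_def, symmetric])
      show "\<forall>A\<in>P. finite A" using finB by blast
      show "\<forall>A\<in>P. \<forall>B\<in>P. A \<noteq> B \<longrightarrow> A \<inter> B = {}" using P by (simp add: partition_on_def disjoint_def)
    qed
    finally show "(\<Prod>B\<in>P. mconst (parity_factor (c B) (card (g B))) *
        (\<Prod>h\<in>B. mvar (end_var (c B = 1) (h \<in> g B)))) = mconst (?q c g) * (\<Prod>h\<in>U. mvar (\<tau> c g h))"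
      by (simp add: prod.distrib mconst_prod partition_onD1[OF P])
  qed
  finally have "bw (\<Prod>B\<in>P. F_poly (card B)) = (\<Sum>c\<in>?C. \<Sum>g\<in>?G. ?q c g *
      of_nat (card {M \<in> matchings U. \<forall>e\<in>M. contractible (\<tau> c g) e}))"
    by (simp add: bw_sum bw_mconst_mult bw_prod_mvar[OF fin])
  also have "\<dots> = (\<Sum>c\<in>?C. \<Sum>g\<in>?G. \<Sum>M\<in>matchings U. if \<forall>e\<in>M. contractible (\<tau> c g) e then ?q c g else 0)"
    by (simp add: sum.If_cases finite_matchings[OF fin] mult.commute Int_def)
  also have "\<dots> = (\<Sum>c\<in>?C. \<Sum>M\<in>matchings U. \<Sum>g\<in>?G. if \<forall>e\<in>M. contractible (\<tau> c g) e then ?q c g else 0)"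
    by (intro sum.cong refl sum.swap)
  also have "\<dots> = (\<Sum>c\<in>?C. \<Sum>M\<in>matchings U.
      t_ind ^ card {B \<in> P. c B = 0 \<and> even (card (B \<inter> cross M (black P c)))})"
  proof (intro sum.cong refl)
    fix c M assume c: "c \<in> ?C" and M: "M \<in> matchings U"
    let ?X = "cross M (black P c)"
    \<comment> \<open>The correct declaration: in every block, the ends whose edge in
      \<open>M\<close> is bichromatic under \<open>c\<close>.\<close>
    define g0 where "g0 = (\<lambda>B\<in>P. B \<inter> ?X)"
    have XU: "?X \<subseteq> U" using M unfolding cross_def matchings_def partition_on_def by blast
    have iff: "(\<forall>e\<in>M. contractible (\<tau> c g) e) \<longleftrightarrow> g = g0" if g: "g \<in> ?G" for g
    proof -
      \<comment> \<open>Gluing the declared subsets into one set of ends makes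
        \<open>contractible_iff_cross\<close> applicable; since blocks are disjoint,
        \<open>g\<close> is recovered by intersecting with them.\<close>
      let ?Y = "\<Union>B\<in>P. g B"
      have gB: "g B \<subseteq> B" if "B \<in> P" for B using g that by auto
      have Yg: "B \<inter> ?Y = g B" if "B \<in> P" for B
      proof -
        have "B \<inter> g B' = {}" if "B' \<in> P" "B' \<noteq> B" for B'
          using that(2) gB[OF that(1)] partition_on_block_unique[OF P \<open>B \<in> P\<close> that(1)] by blast
        then show ?thesis using that gB by blast
      qed
      have YU: "?Y \<subseteq> U" using gB block_subset[OF P] by blast
      have "\<tau> c g h = end_var (h \<in> black P c) (h \<in> ?Y)" if hU: "h \<in> U" for h
      proof -
        obtain B where B: "B \<in> P" "h \<in> B" using hU partition_onD1[OF P] by blast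
        then have "h \<in> ?Y \<longleftrightarrow> h \<in> g B" using Yg[OF B(1)] by blast
        then show ?thesis
          using mem_black_iff[OF P B] unfolding \<tau>_def block[OF B] by simp
      qed
      from contractible_iff_cross[OF M YU this]
      have "(\<forall>e\<in>M. contractible (\<tau> c g) e) \<longleftrightarrow> ?Y = ?X" by blast
      also have "\<dots> \<longleftrightarrow> g = g0"
      proof
        assume "?Y = ?X"
        then have "g B = g0 B" if "B \<in> P" for B using Yg[OF that] that by (simp add: g0_def)
        moreover have "g B = g0 B" if "B \<notin> P" for B using g that by (simp add: g0_def PiE_def extensional_def)
        ultimately show "g = g0" by blast
      next
        assume "g = g0"
        then have "?Y = (\<Union>B\<in>P. B \<inter> ?X)" by (simp add: g0_def)
        also have "\<dots> = \<Union>P \<inter> ?X" by blast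
        also have "\<dots> = ?X" using XU partition_onD1[OF P] by blast
        finally show "?Y = ?X" .
      qed
      finally show ?thesis .
    qed
    have g0: "g0 \<in> ?G" by (auto simp: g0_def)
    have "(\<Sum>g\<in>?G. if \<forall>e\<in>M. contractible (\<tau> c g) e then ?q c g else 0) =
        (\<Sum>g\<in>?G. if g = g0 then ?q c g else 0)"
      by (intro sum.cong refl) (simp add: iff)
    also have "\<dots> = ?q c g0"
      using g0 finP finB by (subst sum.delta) (auto intro!: finite_PiE)
    \<comment> \<open>The factor \<open>t_ind\<close> survives exactly at the even-white blocks:
      color 0 and an even number of bichromatic ends.\<close>
    also have "\<dots> = (\<Prod>B\<in>P. if c B = 0 \<and> even (card (B \<inter> ?X)) then t_ind else 1)"
    proof (intro prod.cong refl)
      fix B assume B: "B \<in> P"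
      have "c B = 0 \<or> c B = 1" using c B by (auto simp: PiE_def Pi_def)
      then show "parity_factor (c B) (card (g0 B)) = (if c B = 0 \<and> even (card (B \<inter> ?X)) then t_ind else 1)"
        using B by (auto simp: parity_factor_def p_par_def g0_def)
    qed
    also have "\<dots> = t_ind ^ card {B \<in> P. c B = 0 \<and> even (card (B \<inter> ?X))}"
      using finP by (simp add: prod.If_cases Int_def)
    finally show "(\<Sum>g\<in>?G. if \<forall>e\<in>M. contractible (\<tau> c g) e then ?q c g else 0) =
        t_ind ^ card {B \<in> P. c B = 0 \<and> even (card (B \<inter> ?X))}" .
  qed
  also have "\<dots> = (\<Sum>M\<in>matchings U. \<Sum>c\<in>?C. t_ind ^ card {B \<in> P. c B = 0 \<and> even (card (B \<inter> cross M (black P c)))})"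
    by (rule sum.swap)
  also have "\<dots> = (\<Sum>M\<in>matchings U. W_poly (part_graph (P, M)) t_ind)"
  proof (intro sum.cong refl)
    fix M assume "M \<in> matchings U"
    then have "(P, M) \<in> structures U" using P by (simp add: structures_def)
    from W_poly_part_graph[OF this, of t_ind]
    show "(\<Sum>c\<in>?C. t_ind ^ card {B \<in> P. c B = 0 \<and> even (card (B \<inter> cross M (black P c)))}) =
        W_poly (part_graph (P, M)) t_ind" by simp
  qed
  finally show ?thesis .
qed


section \<open>Isomorphism classes and orbit counting\<close>

text \<open>A vertex without ends leaves no trace in the partition of the ends, and automorphisms
  could move it while fixing every end.\<close>

definition no_isolated :: "('v, 'h) mgraph \<Rightarrow> bool" where
  "no_isolated G \<longleftrightarrow> (\<forall>v\<in>verts G. \<exists>h\<in>ends G. att G h = v)"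

definition fiber :: "('v, 'h) mgraph \<Rightarrow> 'v \<Rightarrow> 'h set" where
  "fiber G v = {h \<in> ends G. att G h = v}"

definition structure_of :: "('v, 'h) mgraph \<Rightarrow> 'h set set \<times> 'h set set" where
  "structure_of G = (fiber G ` verts G, edges G)"

text \<open>Every fiber is nonempty, so a vertex can be recovered from its fiber and
  \<open>fiber G\<close> is a bijection from vertices to blocks.\<close>

lemma structure_of:
  assumes G: "is_mgraph G" "no_isolated G"
  shows "structure_of G \<in> structures (ends G)"
    and "is_iso (fiber G) (\<lambda>h. h) G (part_graph (structure_of G))"
proof -
  have ne: "fiber G v \<noteq> {}" if "v \<in> verts G" for v
    using G(2) that by (auto simp: no_isolated_def fiber_def)
  show s: "structure_of G \<in> structures (ends G)"
    unfolding structure_of_def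
  proof (rule structuresI)
    show "partition_on (ends G) (fiber G ` verts G)"
    proof (rule partition_onI)
      show "\<Union>(fiber G ` verts G) = ends G" using att_in_verts[OF G(1)] by (auto simp: fiber_def)
      show "{} \<notin> fiber G ` verts G" using ne by (metis imageE)
    qed (auto simp: fiber_def disjnt_def)
    have "{} \<notin> edges G" using G(1) unfolding is_mgraph_def by (metis card.empty zero_neq_numeral)
    then show "partition_on (ends G) (edges G)"
      using G(1) by (simp add: partition_on_def ends_def is_mgraph_def)
  qed (use G(1) in \<open>simp add: is_mgraph_def\<close>)
  have "inj_on (fiber G) (verts G)"
  proof (rule inj_onI)
    fix v w assume v: "v \<in> verts G" and eq: "fiber G v = fiber G w"
    obtain h where "h \<in> fiber G v" using ne[OF v] by blast
    then have "att G h = v" "att G h = w" using eq by (auto simp: fiber_def)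
    then show "v = w" by simp
  qed
  moreover have "att (part_graph (structure_of G)) h = fiber G (att G h)" if "h \<in> ends G" for h
    using that att_in_verts[OF G(1)]
    by (intro att_part_graph_eq[OF structuresD(1)[OF s]]) (auto simp: fiber_def structure_of_def)
  ultimately show "is_iso (fiber G) (\<lambda>h. h) G (part_graph (structure_of G))"
    by (simp add: is_iso_def ends_part_graph[OF s] bij_betw_def) (simp add: structure_of_def)
qed

text \<open>The map of ends alone determines the structure: two ends share a block iff their images
  share a vertex, and the edges are the preimages of those of \<open>G\<close>. The vertex maps may
  differ.\<close>

lemma is_iso_part_graph_unique:
  assumes fin: "finite U" and s: "s \<in> structures U" "s' \<in> structures U"
    and iso: "is_iso \<phi> \<psi> (part_graph s) G" "is_iso \<phi>' \<psi> (part_graph s') G"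
  shows "s = s'"
proof -
  note sD = structuresD[OF s(1)] and sD' = structuresD[OF s(2)]
  note I = is_isoD[OF iso(1)] and I' = is_isoD[OF iso(2)]
  have inj: "inj_on \<psi> U" using I(2) by (simp add: bij_betw_def ends_part_graph[OF s(1)])
  have block_eq: "{h \<in> U. att (part_graph r) h = att (part_graph r) k} = att (part_graph r) k"
    if "r \<in> structures U" "k \<in> U" for r k
    using att_part_graph_eq_iff[OF that(1) att_part_graph(1)[OF that]]
      block_subset[OF structuresD(1)[OF that(1)] att_part_graph(1)[OF that]] by auto
  have same: "att (part_graph s) h = att (part_graph s) k \<longleftrightarrow> att (part_graph s') h = att (part_graph s') k"
    if "h \<in> U" "k \<in> U" for h k
  proof -
    have eq: "\<phi> (att (part_graph s) u) = \<phi>' (att (part_graph s') u)" if "u \<in> U" for u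
      using I(4)[of u] I'(4)[of u] that by (simp add: ends_part_graph[OF s(1)] ends_part_graph[OF s(2)])
    have "att (part_graph s) h = att (part_graph s) k \<longleftrightarrow> \<phi> (att (part_graph s) h) = \<phi> (att (part_graph s) k)"
      using I(1) att_part_graph(1)[OF s(1)] that by (auto simp: bij_betw_def inj_on_def)
    also have "\<dots> \<longleftrightarrow> \<phi>' (att (part_graph s') h) = \<phi>' (att (part_graph s') k)"
      using eq that by simp
    also have "\<dots> \<longleftrightarrow> att (part_graph s') h = att (part_graph s') k"
      using I'(1) att_part_graph(1)[OF s(2)] that by (auto simp: bij_betw_def inj_on_def)
    finally show ?thesis .
  qed
  have blocks: "fst r = att (part_graph r) ` U" if r: "r \<in> structures U" for r
  proof (intro subset_antisym subsetI)
    fix B assume B: "B \<in> fst r"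
    then obtain h where "h \<in> B" using partition_onD3[OF structuresD(1)[OF r]] by (metis ex_in_conv)
    then show "B \<in> att (part_graph r) ` U"
      using att_part_graph_eq[OF structuresD(1)[OF r] B] block_subset[OF structuresD(1)[OF r] B]
      by (metis imageI subsetD)
  qed (use att_part_graph(1)[OF r] in blast)
  have "att (part_graph s) k = att (part_graph s') k" if "k \<in> U" for k
  proof -
    have "att (part_graph s) k = {h \<in> U. att (part_graph s) h = att (part_graph s) k}"
      by (rule block_eq[OF s(1) that, symmetric])
    also have "\<dots> = {h \<in> U. att (part_graph s') h = att (part_graph s') k}"
      using same[OF _ that] by (intro Collect_cong conj_cong refl)
    finally show ?thesis by (simp only: block_eq[OF s(2) that])
  qed
  then have "fst s = fst s'" using blocks[OF s(1)] blocks[OF s(2)] by (simp cong: image_cong)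
  moreover have "snd s = snd s'"
  proof -
    have "(\<lambda>e. \<psi> ` e) ` snd s = (\<lambda>e. \<psi> ` e) ` snd s'" using I(3) I'(3) by simp
    moreover have "inj_on (\<lambda>e. \<psi> ` e) (Pow U)" by (rule inj_on_image_Pow[OF inj])
    moreover have "snd s \<subseteq> Pow U" "snd s' \<subseteq> Pow U"
      using block_subset[OF sD(2)] block_subset[OF sD'(2)] by blast+
    ultimately show ?thesis by (simp add: inj_on_image_eq_iff)
  qed
  ultimately show ?thesis by (simp add: prod_eq_iff)
qed

section \<open>Counting isomorphisms\<close>

lemma card_bijections:
  assumes "finite A" "finite B" "card A = card B"
  shows "card {f \<in> A \<rightarrow>\<^sub>E B. bij_betw f A B} = fact (card A)"
proof -
  have "bij_betw f A B \<longleftrightarrow> inj_on f A" if "f \<in> A \<rightarrow>\<^sub>E B" for f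
  proof
    assume inj: "inj_on f A"
    then have "f ` A = B"
      using that assms by (intro card_subset_eq) (auto simp: card_image)
    with inj show "bij_betw f A B" by (simp add: bij_betw_def)
  qed (simp add: bij_betw_def)
  then have "{f \<in> A \<rightarrow>\<^sub>E B. bij_betw f A B} = {f \<in> A \<rightarrow>\<^sub>E B. inj_on f A}" by blast
  then show ?thesis
    using card_inj_on_subset_funcset[of A B A] assms by (simp add: fact_prod_rev)
qed

text \<open>The isomorphisms from \<open>H\<close> to \<open>G\<close> form a torsor under
  \<open>Aut G\<close>, based at the given one. They may be counted by their end maps because every
  vertex of \<open>G\<close> carries an end, so the end map determines the vertex map.\<close>

lemma card_isos:
  assumes G: "is_mgraph G" "no_isolated G" and H: "is_mgraph H" and iso: "is_iso \<phi>0 \<psi>0 H G"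
  shows "card {\<psi> \<in> ends H \<rightarrow>\<^sub>E ends G. \<exists>\<phi>. is_iso \<phi> \<psi> H G} = card (Aut G)"
proof -
  let ?U = "ends H"
  note I0 = is_isoD[OF iso]
  let ?I = "{\<psi> \<in> ?U \<rightarrow>\<^sub>E ends G. \<exists>\<phi>. is_iso \<phi> \<psi> H G}"
  have into: "\<psi> h \<in> ends G" if "bij_betw \<psi> ?U (ends G)" "h \<in> ?U" for \<psi> h
    using that by (auto simp: bij_betw_def)
  have "bij_betw (\<lambda>(\<phi>, \<alpha>). restrict (\<alpha> \<circ> \<psi>0) ?U) (Aut G) ?I"
  proof (rule bij_betw_imageI)
    show "inj_on (\<lambda>(\<phi>, \<alpha>). restrict (\<alpha> \<circ> \<psi>0) ?U) (Aut G)"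
    proof (rule inj_onI)
      fix p p' assume p: "p \<in> Aut G" "p' \<in> Aut G"
        and eq: "(case p of (\<phi>, \<alpha>) \<Rightarrow> restrict (\<alpha> \<circ> \<psi>0) ?U) = (case p' of (\<phi>, \<alpha>) \<Rightarrow> restrict (\<alpha> \<circ> \<psi>0) ?U)"
      obtain \<phi> \<alpha> \<phi>' \<alpha>' where ps: "p = (\<phi>, \<alpha>)" "p' = (\<phi>', \<alpha>')" by (cases p; cases p')
      have perm: "\<phi> permutes verts G" "\<alpha> permutes ends G" "\<phi>' permutes verts G" "\<alpha>' permutes ends G"
        and i: "is_iso \<phi> \<alpha> G G" "is_iso \<phi>' \<alpha>' G G"
        using p by (simp_all add: Aut_def ps)
      have ends_eq: "\<alpha> k = \<alpha>' k" if k: "k \<in> ends G" for k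
      proof -
        have "k \<in> \<psi>0 ` ?U" using I0(2) k by (simp add: bij_betw_def)
        then obtain h where "h \<in> ?U" "k = \<psi>0 h" by blast
        then show ?thesis using fun_cong[OF eq, of h] by (simp add: ps)
      qed
      have "\<alpha> k = \<alpha>' k" for k
        using ends_eq permutes_not_in[OF perm(2)] permutes_not_in[OF perm(4)] by (cases "k \<in> ends G") auto
      moreover have "\<phi> v = \<phi>' v" for v
      proof (cases "v \<in> verts G")
        case True
        then obtain k where "k \<in> ends G" "att G k = v" using G(2) by (auto simp: no_isolated_def)
        then show ?thesis using is_isoD(4)[OF i(1), of k] is_isoD(4)[OF i(2), of k] ends_eq by simp
      next
        case False
        then show ?thesis using permutes_not_in[OF perm(1)] permutes_not_in[OF perm(3)] by auto
      qed
      ultimately show "p = p'" unfolding ps by blast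
    qed
    show "(\<lambda>(\<phi>, \<alpha>). restrict (\<alpha> \<circ> \<psi>0) ?U) ` Aut G = ?I"
    proof (intro subset_antisym subsetI)
      fix \<psi> assume "\<psi> \<in> (\<lambda>(\<phi>, \<alpha>). restrict (\<alpha> \<circ> \<psi>0) ?U) ` Aut G"
      then obtain \<phi> \<alpha> where a: "(\<phi>, \<alpha>) \<in> Aut G" "\<psi> = restrict (\<alpha> \<circ> \<psi>0) ?U" by auto
      then have i: "is_iso \<phi> \<alpha> G G" by (simp add: Aut_def)
      have "is_iso (\<phi> \<circ> \<phi>0) \<psi> H G"
        by (rule is_iso_cong[OF H is_iso_comp[OF iso i]]) (simp_all add: a)
      moreover from is_isoD(2)[OF this] have "\<psi> \<in> ?U \<rightarrow>\<^sub>E ends G"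
        using into by (auto simp: a(2))
      ultimately show "\<psi> \<in> ?I" by blast
    next
      fix \<psi> assume "\<psi> \<in> ?I"
      then obtain \<phi> where \<psi>: "\<psi> \<in> ?U \<rightarrow>\<^sub>E ends G" "is_iso \<phi> \<psi> H G" by blast
      \<comment> \<open>The quotient of \<open>\<psi>\<close> by \<open>\<psi>0\<close>, continued
        by the identity because \<open>Aut\<close> asks for permutations.\<close>
      define \<alpha> where "\<alpha> k = (if k \<in> ends G then \<psi> (inv_into ?U \<psi>0 k) else k)" for k
      define \<beta> where "\<beta> v = (if v \<in> verts G then \<phi> (inv_into (verts H) \<phi>0 v) else v)" for v
      have i: "is_iso \<beta> \<alpha> G G"
        by (rule is_iso_cong[OF G(1) is_iso_comp[OF is_iso_inv[OF H iso] \<psi>(2)]])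
          (simp_all add: \<alpha>_def \<beta>_def)
      have "\<beta> permutes verts G" "\<alpha> permutes ends G"
        using is_isoD(1,2)[OF i] by (auto intro!: bij_imp_permutes simp: \<alpha>_def \<beta>_def)
      then have "(\<beta>, \<alpha>) \<in> Aut G" using i by (simp add: Aut_def)
      moreover have "\<psi> = restrict (\<alpha> \<circ> \<psi>0) ?U"
      proof
        fix h show "\<psi> h = restrict (\<alpha> \<circ> \<psi>0) ?U h"
          using \<psi>(1) into[OF I0(2), of h] bij_betw_inv_into_left[OF I0(2), of h]
          by (auto simp: \<alpha>_def PiE_def extensional_def)
      qed
      ultimately show "\<psi> \<in> (\<lambda>(\<phi>, \<alpha>). restrict (\<alpha> \<circ> \<psi>0) ?U) ` Aut G" by (metis (no_types, lifting) case_prod_conv imageI)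
    qed
  qed
  then show ?thesis by (simp add: bij_betw_same_card)
qed

text \<open>
  Orbit counting: each bijection from \<open>U\<close> to the ends of \<open>G\<close> pulls \<open>G\<close> back to a
  unique structure on \<open>U\<close>, and each structure so obtained arises from \<open>card (Aut G)\<close> bijections.
\<close>

lemma card_isomorphic_structures:
  assumes G: "is_mgraph G" "no_isolated G" and U: "finite U" "card U = card (ends G)"
  shows "card {s \<in> structures U. \<exists>\<phi> \<psi>. is_iso \<phi> \<psi> (part_graph s) G} * card (Aut G) = fact (card U)"
proof -
  let ?F = "{s \<in> structures U. \<exists>\<phi> \<psi>. is_iso \<phi> \<psi> (part_graph s) G}"
  let ?I = "\<lambda>s. {\<psi> \<in> U \<rightarrow>\<^sub>E ends G. \<exists>\<phi>. is_iso \<phi> \<psi> (part_graph s) G}"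
  have finI: "finite (?I s)" for s
  proof (rule finite_subset)
    show "finite (U \<rightarrow>\<^sub>E ends G)" using U(1) finite_ends[OF G(1)] by (simp add: finite_PiE)
  qed blast
  have "{\<psi> \<in> U \<rightarrow>\<^sub>E ends G. bij_betw \<psi> U (ends G)} = (\<Union>s\<in>?F. ?I s)"
  proof (intro subset_antisym subsetI)
    fix \<psi> assume "\<psi> \<in> {\<psi> \<in> U \<rightarrow>\<^sub>E ends G. bij_betw \<psi> U (ends G)}"
    then have \<psi>: "\<psi> \<in> U \<rightarrow>\<^sub>E ends G" "bij_betw \<psi> U (ends G)" by auto
    define g where "g = inv_into U \<psi>"
    have g: "bij_betw g (ends G) U" unfolding g_def by (rule bij_betw_inv_into[OF \<psi>(2)])
    let ?s = "map_structure g (structure_of G)"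
    note G' = structure_of[OF G]
    have s: "?s \<in> structures U" by (rule map_structure_structures[OF g G'(1)])
    from is_iso_comp[OF G'(2) is_iso_map_structure[OF g G'(1)]]
    obtain \<beta> where iso: "is_iso \<beta> g G (part_graph ?s)" by (auto simp: o_def)
    have gi: "inv_into (ends G) g h = \<psi> h" if "h \<in> U" for h
    proof -
      have "\<psi> h \<in> ends G" "g (\<psi> h) = h"
        using \<psi>(2) that by (auto simp: g_def bij_betw_def)
      then show ?thesis using bij_betw_inv_into_left[OF g] by metis
    qed
    have "is_iso (inv_into (verts G) \<beta>) \<psi> (part_graph ?s) G"
      by (rule is_iso_cong[OF is_mgraph_part_graph[OF s U(1)] is_iso_inv[OF G(1) iso]])
        (simp_all add: gi ends_part_graph[OF s])
    then show "\<psi> \<in> (\<Union>s\<in>?F. ?I s)" using s \<psi>(1) by blast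
  next
    fix \<psi> assume "\<psi> \<in> (\<Union>s\<in>?F. ?I s)"
    then obtain s \<phi> where "s \<in> structures U" "\<psi> \<in> U \<rightarrow>\<^sub>E ends G" "is_iso \<phi> \<psi> (part_graph s) G" by blast
    then show "\<psi> \<in> {\<psi> \<in> U \<rightarrow>\<^sub>E ends G. bij_betw \<psi> U (ends G)}"
      using is_isoD(2) by (fastforce simp: ends_part_graph)
  qed
  then have "fact (card U) = card (\<Union>s\<in>?F. ?I s)"
    using card_bijections[OF U(1) finite_ends[OF G(1)] U(2)] by simp
  also have "\<dots> = (\<Sum>s\<in>?F. card (?I s))"
  proof (rule card_UN_disjoint)
    show "finite ?F" using finite_structures[OF U(1)] by simp
    show "\<forall>s\<in>?F. \<forall>s'\<in>?F. s \<noteq> s' \<longrightarrow> ?I s \<inter> ?I s' = {}"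
      using is_iso_part_graph_unique[OF U(1)] by blast
  qed (use finI in blast)
  also have "\<dots> = (\<Sum>s\<in>?F. card (Aut G))"
  proof (intro sum.cong refl)
    fix s assume "s \<in> ?F"
    then obtain \<phi> \<psi> where s: "s \<in> structures U" and iso: "is_iso \<phi> \<psi> (part_graph s) G" by blast
    show "card (?I s) = card (Aut G)"
      using card_isos[OF G is_mgraph_part_graph[OF s U(1)] iso] by (simp add: ends_part_graph[OF s])
  qed
  finally show ?thesis by simp
qed

section \<open>Profiles as degree statistics\<close>

lemma vdegree_in_keys:
  assumes "finite (verts G)" "has_profile G n"
  shows "vdegree G ` verts G \<subseteq> Poly_Mapping.keys n"
proof
  fix k assume "k \<in> vdegree G ` verts G"
  then have "{v \<in> verts G. vdegree G v = k} \<noteq> {}" by blast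
  then have "card {v \<in> verts G. vdegree G v = k} \<noteq> 0" using assms(1) by simp
  then show "k \<in> Poly_Mapping.keys n"
    using assms(2) by (simp add: has_profile_def in_keys_iff)
qed

lemma sum_by_degree:
  fixes f :: "nat \<Rightarrow> nat"
  assumes "finite (verts G)" "has_profile G n"
  shows "(\<Sum>v\<in>verts G. f (vdegree G v)) = (\<Sum>k\<in>Poly_Mapping.keys n. Poly_Mapping.lookup n k * f k)"
  using sum.group[OF assms(1) finite_keys vdegree_in_keys[OF assms], of "\<lambda>v. f (vdegree G v)"] assms(2)
  by (simp add: has_profile_def)

lemma prod_by_degree:
  fixes f :: "nat \<Rightarrow> 'a::comm_monoid_mult"
  assumes "finite (verts G)" "has_profile G n"
  shows "(\<Prod>v\<in>verts G. f (vdegree G v)) = (\<Prod>k\<in>Poly_Mapping.keys n. f k ^ Poly_Mapping.lookup n k)"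
  using prod.group[OF assms(1) finite_keys vdegree_in_keys[OF assms], of "\<lambda>v. f (vdegree G v)"] assms(2)
  by (simp add: has_profile_def)

text \<open>The handshake count: grouping the ends by their vertex gives the sum of the degrees.
  Hence the exponent of u is the number of ends.\<close>

lemma card_ends_profile:
  assumes G: "is_mgraph G" and n: "has_profile G n"
  shows "card (ends G) = profile_weight n"
proof -
  have fin: "finite (verts G)" using G by (simp add: is_mgraph_def)
  have "att G ` ends G \<subseteq> verts G" using G by (simp add: is_mgraph_def)
  from sum.group[OF finite_ends[OF G] fin this, of "\<lambda>h. 1::nat"]
  have "card (ends G) = (\<Sum>v\<in>verts G. vdegree G v)"
    by (simp add: vdegree_def)
  then show ?thesis
    using sum_by_degree[OF fin n, of "\<lambda>k. k"] by (simp add: profile_weight_def mult.commute)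
qed

lemma no_isolated_profile:
  assumes G: "is_mgraph G" and n: "has_profile G n" "is_profile n"
  shows "no_isolated G"
  unfolding no_isolated_def
proof
  fix v assume v: "v \<in> verts G"
  have "finite {v \<in> verts G. vdegree G v = 0}" using G by (simp add: is_mgraph_def)
  moreover have "card {v \<in> verts G. vdegree G v = 0} = 0"
    using n unfolding has_profile_def is_profile_def by metis
  ultimately have "{v \<in> verts G. vdegree G v = 0} = {}" by (metis card_0_eq)
  then have "v \<notin> {v \<in> verts G. vdegree G v = 0}" by simp
  then have "vdegree G v \<noteq> 0" using v by simp
  then show "\<exists>h\<in>ends G. att G h = v" unfolding vdegree_def by (metis (mono_tags, lifting) Collect_empty_eq card.empty)
qed

text \<open>The entry at 0 vanishes, so a nonzero entry n_k has k at least 1, and both k and n_k are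
  bounded by k n_k, hence by \<open>m\<close>. A profile is thus determined by a function from
  \<open>{..m}\<close> to \<open>{..m}\<close>.\<close>

lemma finite_profiles: "finite {n. is_profile n \<and> profile_weight n = m}"
proof -
  let ?S = "{n. is_profile n \<and> profile_weight n = m}"
  have le: "k \<le> m \<and> Poly_Mapping.lookup n k \<le> m" if "n \<in> ?S" "Poly_Mapping.lookup n k \<noteq> 0" for n k
  proof -
    have "k * Poly_Mapping.lookup n k \<le> profile_weight n"
      unfolding profile_weight_def using that
      by (intro member_le_sum[of k _ "\<lambda>k. k * Poly_Mapping.lookup n k"]) (auto simp: in_keys_iff)
    moreover have "k \<noteq> 0" using that by (metis (mono_tags) is_profile_def mem_Collect_eq)
    ultimately show ?thesis using that
      by (metis (mono_tags, lifting) le_trans mem_Collect_eq mult_le_mono1 nat_mult_1 nat_mult_1_right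
          less_one not_less nat_mult_le_cancel1 mult_le_mono2)
  qed
  have "inj_on (\<lambda>n. restrict (Poly_Mapping.lookup n) {..m}) ?S"
  proof (rule inj_onI, rule poly_mapping_eqI)
    fix n n' k
    assume n: "n \<in> ?S" "n' \<in> ?S"
      and eq: "restrict (Poly_Mapping.lookup n) {..m} = restrict (Poly_Mapping.lookup n') {..m}"
    show "Poly_Mapping.lookup n k = Poly_Mapping.lookup n' k"
    proof (cases "k \<le> m")
      case True
      then show ?thesis using fun_cong[OF eq, of k] by simp
    next
      case False
      then show ?thesis using le[OF n(1), of k] le[OF n(2), of k] by metis
    qed
  qed
  moreover have "(\<lambda>n. restrict (Poly_Mapping.lookup n) {..m}) ` ?S \<subseteq> {..m} \<rightarrow>\<^sub>E {..m}"
  proof (intro image_subsetI, simp only: restrict_PiE, rule Pi_I)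
    fix n k assume "n \<in> ?S"
    then show "Poly_Mapping.lookup n k \<in> {..m}" using le[of n k] by (cases "Poly_Mapping.lookup n k = 0") simp_all
  qed
  ultimately show ?thesis
    by (rule inj_on_finite) (simp add: finite_PiE)
qed

lemma has_profile_part_graph_ex1:
  assumes s: "s \<in> structures U" and fin: "finite U"
  shows "\<exists>!n. has_profile (part_graph s) n"
proof -
  let ?f = "\<lambda>k. card {v \<in> verts (part_graph s). vdegree (part_graph s) v = k}"
  have "finite (fst s)" using structuresD(1)[OF s] fin by (blast intro: finite_elements)
  moreover have "{k. ?f k \<noteq> 0} \<subseteq> vdegree (part_graph s) ` fst s"
    by (auto simp: card_eq_0_iff)
  ultimately have "finite {k. ?f k \<noteq> 0}" by (meson finite_imageI finite_subset)
  then have "Poly_Mapping.lookup (Abs_poly_mapping ?f) = ?f" by (rule lookup_Abs_poly_mapping)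
  then have "has_profile (part_graph s) (Abs_poly_mapping ?f)" by (simp add: has_profile_def)
  moreover have "n = n'" if "has_profile (part_graph s) n" "has_profile (part_graph s) n'" for n n'
    using that by (auto simp: has_profile_def intro: poly_mapping_eqI)
  ultimately show ?thesis by blast
qed

lemma is_profile_part_graph:
  assumes s: "s \<in> structures U" and fin: "finite U" and n: "has_profile (part_graph s) n"
  shows "is_profile n"
proof -
  have "card B \<noteq> 0" if "B \<in> fst s" for B
    using partition_onD3[OF structuresD(1)[OF s]] block_subset[OF structuresD(1)[OF s] that] fin that
    by (metis card_0_eq finite_subset)
  then have "{B \<in> fst s. vdegree (part_graph s) B = 0} = {}"
    using vdegree_part_graph[OF s] by auto
  then show ?thesis using n unfolding is_profile_def has_profile_def by (metis card.empty part_graph_simps(1))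
qed

text \<open>A block is named by its minimum, which lies in it; disjoint blocks therefore receive
  different names.\<close>

lemma part_graph_ngraph:
  fixes s :: "nat set set \<times> nat set set"
  assumes s: "s \<in> structures U" and fin: "finite U"
  obtains K :: ngraph and \<phi> \<psi> where "is_mgraph K" "is_iso \<phi> \<psi> (part_graph s) K"
proof -
  define K :: ngraph where
    "K = \<lparr>verts = Min ` fst s, edges = snd s, att = (\<lambda>h. Min (att (part_graph s) h))\<rparr>"
  note sD = structuresD[OF s]
  have "Min B \<in> B" if "B \<in> fst s" for B
    using partition_onD3[OF sD(1)] block_subset[OF sD(1) that] fin that
    by (metis Min_in finite_subset)
  then have "inj_on Min (fst s)"
    using partition_on_block_unique[OF sD(1)] by (metis inj_onI)
  moreover have "ends K = U" using ends_part_graph[OF s] by (simp add: ends_def K_def)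
  ultimately have "is_iso Min (\<lambda>h. h) (part_graph s) K"
    by (simp add: is_iso_def ends_part_graph[OF s] bij_betw_def) (simp add: K_def)
  then show thesis using that is_mgraph_iso[OF is_mgraph_part_graph[OF s fin]] by blast
qed

text \<open>\<open>iso_rel\<close> compares only graphs with natural numbers as vertices, whereas
  \<open>part_graph s\<close> has sets as vertices; this is the class that it represents.\<close>

definition iso_class :: "nat set set \<times> nat set set \<Rightarrow> ngraph set" where
  "iso_class s = {K. is_mgraph K \<and> (\<exists>\<phi> \<psi>. is_iso \<phi> \<psi> (part_graph s) K)}"

lemma iso_rel_Image:
  assumes "s \<in> structures U" "finite U" "K \<in> iso_class s"
  shows "iso_rel `` {K} = iso_class s"
proof -
  have K: "is_mgraph K" "\<exists>\<phi> \<psi>. is_iso \<phi> \<psi> (part_graph s) K" using assms(3) by (auto simp: iso_class_def)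
  have "(\<exists>\<phi> \<psi>. is_iso \<phi> \<psi> K L) \<longleftrightarrow> (\<exists>\<phi> \<psi>. is_iso \<phi> \<psi> (part_graph s) L)" for L :: ngraph
    using K(2) is_iso_comp is_iso_inv[OF is_mgraph_part_graph[OF assms(1,2)]] by metis
  then show ?thesis using K(1) by (auto simp: iso_rel_def iso_class_def)
qed

text \<open>Existence follows from the orbit count: a factorial is nonzero, so the number of
  isomorphic structures is too.\<close>

lemma ngraph_structure:
  assumes G: "is_mgraph G" "no_isolated G" and U: "finite U" "card U = card (ends G)"
  obtains s where "s \<in> structures U" "G \<in> iso_class s"
proof -
  have "card {s \<in> structures U. \<exists>\<phi> \<psi>. is_iso \<phi> \<psi> (part_graph s) G} \<noteq> 0"
    using card_isomorphic_structures[OF assms] by (metis fact_nonzero mult_is_0)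
  then have "{s \<in> structures U. \<exists>\<phi> \<psi>. is_iso \<phi> \<psi> (part_graph s) G} \<noteq> {}"
    by (metis card.empty)
  then show thesis using that G(1) by (auto simp: iso_class_def)
qed

text \<open>A predicate covers all graphs and connected graphs at once; it occurs as
  \<open>Q\<close> and as \<open>Q'\<close> because classes and structures have different vertex
  types. The structures belonging to one class have equal weight and their number is m! / card (Aut
  G), which turns 1 / card (Aut G) into 1 / m!.\<close>

lemma graph_series_nth:
  fixes Q :: "ngraph \<Rightarrow> bool" and Q' :: "(nat set, nat) mgraph \<Rightarrow> bool"
  assumes inv: "\<And>H G \<phi> \<psi>. is_mgraph H \<Longrightarrow> is_iso \<phi> \<psi> H G \<Longrightarrow> Q' H \<longleftrightarrow> Q G"
  shows "graph_series (\<lambda>n. {G. is_mgraph G \<and> has_profile G n \<and> Q G} // iso_rel) $ m =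
    (\<Sum>s | s \<in> structures {..<m} \<and> Q' (part_graph s). weight s) * mconst (1 / fact m)"
proof -
  let ?U = "{..<m}"
  let ?S = "{s \<in> structures ?U. Q' (part_graph s)}"
  let ?N = "{n. is_profile n \<and> profile_weight n = m}"
  let ?X = "\<lambda>n. {G. is_mgraph G \<and> has_profile G n \<and> Q G}"
  let ?Sn = "\<lambda>n. {s \<in> ?S. has_profile (part_graph s) n}"
  \<comment> \<open>Each structure has exactly one profile, so the double sum over profiles and
    structures collapses to a single sum at the end.\<close>
  define prof where "prof s = (THE n. has_profile (part_graph s) n)" for s :: "nat set set \<times> nat set set"
  have finS: "finite ?S" using finite_structures[of ?U] by simp
  have prof: "prof s = n \<longleftrightarrow> has_profile (part_graph s) n" if "s \<in> structures ?U" for s n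
    using has_profile_part_graph_ex1[OF that] unfolding prof_def by (metis finite_lessThan theI')
  have mg: "is_mgraph (part_graph s)" if "s \<in> structures ?U" for s
    using is_mgraph_part_graph[OF that] by simp
  have classes: "?X n // iso_rel = iso_class ` ?Sn n" if n: "n \<in> ?N" for n
  proof (intro subset_antisym subsetI)
    fix C assume "C \<in> ?X n // iso_rel"
    then obtain G where G: "is_mgraph G" "has_profile G n" "Q G" and C: "C = iso_rel `` {G}"
      by (auto simp: quotient_def)
    have "card ?U = card (ends G)" using card_ends_profile[OF G(1,2)] n by simp
    moreover have "no_isolated G" using no_isolated_profile[OF G(1,2)] n by blast
    ultimately obtain s where s: "s \<in> structures ?U" "G \<in> iso_class s"
      using ngraph_structure[OF G(1), of ?U] by auto
    then obtain \<phi> \<psi> where iso: "is_iso \<phi> \<psi> (part_graph s) G" by (auto simp: iso_class_def)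
    have "Q' (part_graph s)" using inv[OF mg[OF s(1)] iso] G(3) by simp
    moreover have "has_profile (part_graph s) n"
      using has_profile_iso[OF G(1) is_iso_inv[OF mg[OF s(1)] iso] G(2)] .
    ultimately have "s \<in> ?Sn n" using s(1) by blast
    moreover have "C = iso_class s" using C iso_rel_Image[OF s(1) _ s(2)] by simp
    ultimately show "C \<in> iso_class ` ?Sn n" by blast
  next
    fix C assume "C \<in> iso_class ` ?Sn n"
    then obtain s where s: "s \<in> structures ?U" "Q' (part_graph s)" "has_profile (part_graph s) n"
      and C: "C = iso_class s" by blast
    obtain K :: ngraph and \<phi> \<psi> where K: "is_mgraph K" "is_iso \<phi> \<psi> (part_graph s) K"
      using part_graph_ngraph[OF s(1)] by auto
    have "K \<in> ?X n"
      using K inv[OF mg[OF s(1)] K(2)] s has_profile_iso[OF mg[OF s(1)] K(2)] by blast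
    moreover have "C = iso_rel `` {K}"
      unfolding C by (rule iso_rel_Image[OF s(1), symmetric]) (use K in \<open>auto simp: iso_class_def\<close>)
    ultimately show "C \<in> ?X n // iso_rel" by (auto simp: quotient_def)
  qed
  have "(\<Sum>C\<in>?X n // iso_rel. graph_term n (representative C)) =
      (\<Sum>s\<in>?Sn n. weight s) * mconst (1 / fact m)" if n: "n \<in> ?N" for n
  proof -
    have "graph_term n (representative C) = (\<Sum>s\<in>{s \<in> ?Sn n. iso_class s = C}. weight s) * mconst (1 / fact m)"
      if C: "C \<in> iso_class ` ?Sn n" for C
    proof -
      obtain s0 where s0: "s0 \<in> structures ?U" "Q' (part_graph s0)" "has_profile (part_graph s0) n"
        and C0: "C = iso_class s0" using C by blast
      define G where "G = representative C"
      obtain K :: ngraph and \<phi>1 \<psi>1 where "is_mgraph K" "is_iso \<phi>1 \<psi>1 (part_graph s0) K"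
        using part_graph_ngraph[OF s0(1) finite_lessThan] .
      then have "K \<in> C" by (auto simp: C0 iso_class_def)
      then have "C \<noteq> {}" by blast
      then have GC: "G \<in> C" unfolding G_def representative_def by (simp add: some_in_eq)
      then obtain \<phi>0 \<psi>0 where G: "is_mgraph G" and iso0: "is_iso \<phi>0 \<psi>0 (part_graph s0) G"
        by (auto simp: C0 iso_class_def)
      have Gn: "has_profile G n" by (rule has_profile_iso[OF mg[OF s0(1)] iso0 s0(3)])
      have ni: "no_isolated G" using no_isolated_profile[OF G Gn] n by blast
      have ce: "card ?U = card (ends G)" using card_ends_profile[OF G Gn] n by simp
      let ?F = "{s \<in> structures ?U. \<exists>\<phi> \<psi>. is_iso \<phi> \<psi> (part_graph s) G}"
      \<comment> \<open>The profile and \<open>Q'\<close> are isomorphism invariants, so being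
        isomorphic to the representative already implies both.\<close>
      have F: "{s \<in> ?Sn n. iso_class s = C} = ?F"
      proof (intro subset_antisym subsetI)
        fix s assume "s \<in> {s \<in> ?Sn n. iso_class s = C}"
        then show "s \<in> ?F" using GC by (auto simp: iso_class_def)
      next
        fix s assume "s \<in> ?F"
        then obtain \<phi> \<psi> where s: "s \<in> structures ?U" and iso: "is_iso \<phi> \<psi> (part_graph s) G" by blast
        have "Q' (part_graph s)"
          using inv[OF mg[OF s] iso] inv[OF mg[OF s0(1)] iso0] s0(2) by simp
        moreover have "has_profile (part_graph s) n"
          using has_profile_iso[OF G is_iso_inv[OF mg[OF s] iso] Gn] .
        moreover have "G \<in> iso_class s" using G iso by (auto simp: iso_class_def)
        then have "iso_class s = C"
          using iso_rel_Image[OF s, of G] iso_rel_Image[OF s0(1), of G] GC C0 by simp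
        ultimately show "s \<in> {s \<in> ?Sn n. iso_class s = C}" using s by blast
      qed
      define w where "w = W_poly G t_ind * (\<Prod>k\<in>Poly_Mapping.keys n. xi k ^ Poly_Mapping.lookup n k)"
      have w: "weight s = w" if sF: "s \<in> ?F" for s
      proof -
        obtain \<phi> \<psi> where s: "s \<in> structures ?U" and iso: "is_iso \<phi> \<psi> (part_graph s) G" using sF by blast
        have sn: "has_profile (part_graph s) n"
          using has_profile_iso[OF G is_iso_inv[OF mg[OF s] iso] Gn] .
        have "finite (verts (part_graph s))" using mg[OF s] by (simp add: is_mgraph_def)
        from prod_by_degree[OF this sn, of xi]
        have "(\<Prod>B\<in>fst s. xi (card B)) = (\<Prod>k\<in>Poly_Mapping.keys n. xi k ^ Poly_Mapping.lookup n k)"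
          using vdegree_part_graph[OF s] by simp
        then show ?thesis by (simp add: weight_def w_def W_poly_iso[OF mg[OF s] iso])
      qed
      have orbit: "card ?F * card (Aut G) = fact m"
        using card_isomorphic_structures[OF G ni _ ce] by simp
      have "card (Aut G) \<noteq> 0" using orbit by (metis fact_nonzero mult_is_0)
      then have frac: "1 / of_nat (card (Aut G)) = of_nat (card ?F) * (1 / fact m :: rat)"
        using arg_cong[OF orbit, of "of_nat :: nat \<Rightarrow> rat"] by (simp add: field_simps)
      have "graph_term n G = w * mconst (1 / of_nat (card (Aut G)))"
        by (simp add: graph_term_def w_def)
      also have "\<dots> = w * (mconst (of_nat (card ?F)) * mconst (1 / fact m))"
        unfolding frac mconst_mult ..
      also have "\<dots> = (of_nat (card ?F) * w) * mconst (1 / fact m)"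
        by (simp add: mconst_of_nat mult_ac)
      also have "of_nat (card ?F) * w = (\<Sum>s\<in>?F. weight s)"
        using w by simp
      finally show ?thesis unfolding F G_def .
    qed
    then have "(\<Sum>C\<in>?X n // iso_rel. graph_term n (representative C)) =
        (\<Sum>C\<in>iso_class ` ?Sn n. \<Sum>s\<in>{s \<in> ?Sn n. iso_class s = C}. weight s) * mconst (1 / fact m)"
      unfolding classes[OF n] sum_distrib_right by (rule sum.cong[OF refl])
    also have "(\<Sum>C\<in>iso_class ` ?Sn n. \<Sum>s\<in>{s \<in> ?Sn n. iso_class s = C}. weight s) = (\<Sum>s\<in>?Sn n. weight s)"
      by (rule sum.image_gen[symmetric]) (rule finite_subset[OF _ finS], blast)
    finally show ?thesis .
  qed
  then have "graph_series (\<lambda>n. ?X n // iso_rel) $ m =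
      (\<Sum>n\<in>?N. \<Sum>s\<in>?Sn n. weight s) * mconst (1 / fact m)"
    by (simp add: graph_series_def sum_distrib_right)
  also have "(\<Sum>n\<in>?N. \<Sum>s\<in>?Sn n. weight s) = (\<Sum>n\<in>?N. \<Sum>s\<in>{s \<in> ?S. prof s = n}. weight s)"
    by (intro sum.cong refl) (use prof in auto)
  also have "\<dots> = (\<Sum>s\<in>?S. weight s)"
  proof (rule sum.group[OF finS finite_profiles], rule image_subsetI)
    fix s assume "s \<in> ?S"
    then have s: "s \<in> structures ?U" by blast
    have n: "has_profile (part_graph s) (prof s)" using prof[OF s] by blast
    show "prof s \<in> ?N"
      using is_profile_part_graph[OF s _ n] card_ends_profile[OF mg[OF s] n]
      by (simp add: ends_part_graph[OF s])
  qed
  finally show ?thesis .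
qed


section \<open>The two generating functions\<close>

text \<open>The distinguished point is \<open>n\<close>, and its piece is \<open>insert n Y\<close>
  with \<open>Y\<close> a subset of \<open>{..<n}\<close>. As \<open>f\<close> and \<open>g\<close>
  see only cardinalities, the sum is grouped by k = card \<open>Y\<close>, whence the binomial
  coefficient and the argument \<open>Suc k\<close>.\<close>

lemma split_recurrence:
  fixes f g :: "nat set \<Rightarrow> 'a::comm_ring_1"
  assumes split: "\<And>U x. finite U \<Longrightarrow> x \<in> U \<Longrightarrow> f U = (\<Sum>K | K \<subseteq> U \<and> x \<in> K. g K * f (U - K))"
    and f: "\<And>U V. finite U \<Longrightarrow> finite V \<Longrightarrow> card U = card V \<Longrightarrow> f U = f V"
    and g: "\<And>U V. finite U \<Longrightarrow> finite V \<Longrightarrow> card U = card V \<Longrightarrow> g U = g V"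
  shows "f {..<Suc n} = (\<Sum>k=0..n. of_nat (n choose k) * g {..<Suc k} * f {..<n - k})"
proof -
  have "{K. K \<subseteq> {..<Suc n} \<and> n \<in> K} = insert n ` Pow {..<n}"
  proof (intro subset_antisym subsetI)
    fix K assume K: "K \<in> {K. K \<subseteq> {..<Suc n} \<and> n \<in> K}"
    then have "K = insert n (K - {n})" "K - {n} \<in> Pow {..<n}" by auto
    then show "K \<in> insert n ` Pow {..<n}" by (rule image_eqI)
  qed auto
  then have "f {..<Suc n} = (\<Sum>K\<in>insert n ` Pow {..<n}. g K * f ({..<Suc n} - K))"
    using split[of "{..<Suc n}" n] by simp
  also have "\<dots> = (\<Sum>Y\<in>Pow {..<n}. g (insert n Y) * f ({..<Suc n} - insert n Y))"
    by (subst sum.reindex) (auto simp: inj_on_def)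
  also have "\<dots> = (\<Sum>Y\<in>Pow {..<n}. g {..<Suc (card Y)} * f {..<n - card Y})"
  proof (intro sum.cong refl arg_cong2[where f = "(*)"])
    fix Y assume "Y \<in> Pow {..<n}"
    then have Y: "Y \<subseteq> {..<n}" "finite Y" "n \<notin> Y" by (auto intro: finite_subset)
    show "g (insert n Y) = g {..<Suc (card Y)}" using Y by (intro g) simp_all
    have "{..<Suc n} - insert n Y = {..<n} - Y" by auto
    then show "f ({..<Suc n} - insert n Y) = f {..<n - card Y}"
      using Y by (intro f) (simp_all add: card_Diff_subset)
  qed
  also have "\<dots> = (\<Sum>k=0..n. of_nat (n choose k) * (g {..<Suc k} * f {..<n - k}))"
    using sum_Pow_card[of "{..<n}" "\<lambda>k. g {..<Suc k} * f {..<n - k}"] by simp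
  finally show ?thesis by (simp add: mult.assoc)
qed

text \<open>For finite \<open>U\<close> this is the complete Bell polynomial in f 1, f 2, and so on,
  of index card \<open>U\<close>.\<close>

definition partition_sum :: "(nat \<Rightarrow> 'a::comm_ring_1) \<Rightarrow> 'h set \<Rightarrow> 'a" where
  "partition_sum f U = (\<Sum>P | partition_on U P. \<Prod>B\<in>P. f (card B))"

lemma partition_sum_cong:
  assumes "finite U" "finite V" "card U = card V"
  shows "partition_sum f U = partition_sum f V"
proof -
  obtain g where g: "bij_betw g U V" using finite_same_card_bij[OF assms] by blast
  let ?g' = "inv_into U g"
  show ?thesis unfolding partition_sum_def
  proof (rule sum.reindex_bij_witness[where j = "\<lambda>P. (\<lambda>B. g ` B) ` P" and i = "\<lambda>P. (\<lambda>B. ?g' ` B) ` P"])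
    fix P assume "P \<in> {P. partition_on U P}"
    then have P: "partition_on U P" by simp
    show "(\<lambda>B. ?g' ` B) ` (\<lambda>B. g ` B) ` P = P"
      by (rule image_blocks_cancel[OF P]) (rule bij_betw_inv_into_left[OF g])
    show "(\<lambda>B. g ` B) ` P \<in> {P. partition_on V P}" using partition_on_image[OF g P] by simp
    have inj: "inj_on g U" using g by (simp add: bij_betw_def)
    have "inj_on (\<lambda>B. g ` B) P"
      using inj_on_image_Pow[OF inj] by (rule inj_on_subset) (use block_subset[OF P] in blast)
    then have "(\<Prod>B\<in>(\<lambda>B. g ` B) ` P. f (card B)) = (\<Prod>B\<in>P. f (card (g ` B)))"
      by (simp add: prod.reindex)
    also have "\<dots> = (\<Prod>B\<in>P. f (card B))"
      by (intro prod.cong refl arg_cong[where f = f] card_image inj_on_subset[OF inj] block_subset[OF P])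
    finally show "(\<Prod>B\<in>(\<lambda>B. g ` B) ` P. f (card B)) = (\<Prod>B\<in>P. f (card B))" .
  next
    fix P assume "P \<in> {P. partition_on V P}"
    then have P: "partition_on V P" by simp
    show "(\<lambda>B. g ` B) ` (\<lambda>B. ?g' ` B) ` P = P"
      by (rule image_blocks_cancel[OF P]) (rule bij_betw_inv_into_right[OF g])
    show "(\<lambda>B. ?g' ` B) ` P \<in> {P. partition_on U P}"
      using partition_on_image[OF bij_betw_inv_into[OF g] P] by simp
  qed
qed

text \<open>A partition of \<open>U\<close> amounts to its block \<open>K\<close> containing
  \<open>x\<close> together with a partition of the remaining points.\<close>

lemma partition_sum_split:
  assumes fin: "finite U" and x: "x \<in> U"
  shows "partition_sum f U = (\<Sum>K | K \<subseteq> U \<and> x \<in> K. f (card K) * partition_sum f (U - K))"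
proof -
  let ?I = "{K. K \<subseteq> U \<and> x \<in> K}"
  have ins: "partition_on U (insert K P) \<and> K \<notin> P"
    if "K \<subseteq> U" "x \<in> K" "partition_on (U - K) P" for K P
  proof -
    have "\<Union>P = U - K" using that(3) by (simp add: partition_on_def)
    then have "disjnt K (\<Union>P)" "K \<notin> P" using that(2) by (auto simp: disjnt_def)
    then show ?thesis using partition_on_insert[of K P U] that by blast
  qed
  have "(\<Sum>K\<in>?I. f (card K) * partition_sum f (U - K)) =
      (\<Sum>K\<in>?I. \<Sum>P\<in>{P. partition_on (U - K) P}. f (card K) * (\<Prod>B\<in>P. f (card B)))"
    by (simp add: partition_sum_def sum_distrib_left)
  also have "\<dots> = (\<Sum>(K, P)\<in>(SIGMA K:?I. {P. partition_on (U - K) P}). f (card K) * (\<Prod>B\<in>P. f (card B)))"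
    by (rule sum.Sigma) (use fin finitely_many_partition_on[of "U - _"] in simp_all)
  also have "\<dots> = partition_sum f U"
    unfolding partition_sum_def
  proof (rule sum.reindex_bij_witness[where j = "\<lambda>(K, P). insert K P"
        and i = "\<lambda>P. (THE B. B \<in> P \<and> x \<in> B, P - {THE B. B \<in> P \<and> x \<in> B})"])
    fix p assume p: "p \<in> (SIGMA K:?I. {P. partition_on (U - K) P})"
    obtain K P where ps: "p = (K, P)" by (cases p)
    have K: "K \<subseteq> U" "x \<in> K" and P: "partition_on (U - K) P" using p ps by auto
    note KP = ins[OF K P]
    have the: "(THE B. B \<in> insert K P \<and> x \<in> B) = K"
    proof (rule the_equality)
      show "B = K" if "B \<in> insert K P \<and> x \<in> B" for B
        using partition_on_block_unique[of U "insert K P" B K x] KP that K(2) by blast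
    qed (use K(2) in simp)
    show "(THE B. B \<in> (case p of (K, P) \<Rightarrow> insert K P) \<and> x \<in> B,
        (case p of (K, P) \<Rightarrow> insert K P) - {THE B. B \<in> (case p of (K, P) \<Rightarrow> insert K P) \<and> x \<in> B}) = p"
      unfolding ps prod.case the using KP by simp
    show "(case p of (K, P) \<Rightarrow> insert K P) \<in> {P. partition_on U P}"
      using KP by (simp add: ps)
    have "finite P" using P fin by (intro finite_elements[of "U - K"]) simp_all
    then show "(\<Prod>B\<in>(case p of (K, P) \<Rightarrow> insert K P). f (card B)) =
        (case p of (K, P) \<Rightarrow> f (card K) * (\<Prod>B\<in>P. f (card B)))"
      using KP by (simp add: ps)
  next
    fix P assume "P \<in> {P. partition_on U P}"
    then have P: "partition_on U P" by simp
    obtain K where K: "K \<in> P" "x \<in> K" using x partition_onD1[OF P] by blast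
    have the: "(THE B. B \<in> P \<and> x \<in> B) = K"
      using K partition_on_block_unique[OF P] by (intro the_equality) blast+
    have "disjnt K (\<Union>(P - {K}))"
      using P K(1) by (auto simp: partition_on_def disjoint_def disjnt_def)
    moreover have "insert K (P - {K}) = P" using K(1) by blast
    ultimately have "partition_on (U - K) (P - {K})" "K \<subseteq> U"
      using partition_on_insert[of K "P - {K}" U] P by simp_all
    then show "(THE B. B \<in> P \<and> x \<in> B, P - {THE B. B \<in> P \<and> x \<in> B}) \<in> (SIGMA K:?I. {P. partition_on (U - K) P})"
      unfolding the using K(2) by simp
    show "(case (THE B. B \<in> P \<and> x \<in> B, P - {THE B. B \<in> P \<and> x \<in> B}) of (K, P) \<Rightarrow> insert K P) = P"
      unfolding the using K(1) by auto
  qed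
  finally show ?thesis by simp
qed

text \<open>The exponential formula. Splitting off the block of one point is the coefficient form of
  E' = S' E, the equation that characterizes the composite.\<close>

lemma (in rat_algebra) exp_egf:
  fixes f :: "nat \<Rightarrow> 'a"
  assumes "f 0 = 0"
  shows "fps_map \<kappa> (fps_exp 1) oo egf f = egf (\<lambda>n. partition_sum f {..<n})"
proof (rule fps_exp_compose_unique)
  show "fps_deriv (egf (\<lambda>n. partition_sum f {..<n})) = fps_deriv (egf f) * egf (\<lambda>n. partition_sum f {..<n})"
  proof (rule egf_deriv_eq)
    fix n
    have "partition_sum f {..<Suc n} =
        (\<Sum>k=0..n. of_nat (n choose k) * f (card {..<Suc k}) * partition_sum f {..<n - k})"
      by (rule split_recurrence) (fact partition_sum_split, fact partition_sum_cong, simp)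
    then show "partition_sum f {..<Suc n} =
        (\<Sum>k=0..n. of_nat (n choose k) * f (Suc k) * partition_sum f {..<n - k})"
      by (simp only: card_lessThan)
  qed
  have "{P. partition_on ({} :: nat set) P} = {{}}" by (auto simp: partition_on_empty)
  then have "partition_sum f ({} :: nat set) = 1" by (simp add: partition_sum_def)
  then show "egf (\<lambda>n. partition_sum f {..<n}) $ 0 = 1"
    by (simp add: egf_def hom_one)
qed (simp add: egf_def assms)

section \<open>Application to the two polynomial rings\<close>

interpretation coeff: rat_algebra "mconst :: rat \<Rightarrow> coeff_ring"
  by unfold_locales (simp_all add: mconst_add mconst_mult mconst_one)

interpretation bwyz: rat_algebra "\<lambda>q. mconst (mconst q) :: bwyz_ring"
  by unfold_locales (simp_all add: mconst_add mconst_mult mconst_one)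

text \<open>The value at 0 is set to 0 by hand, because \<open>F_poly 0\<close> is 1 + t while
  substitution into exp requires constant term 0.\<close>

lemma exp_series_S_series:
  "exp_series S_series = bwyz.egf (\<lambda>n. partition_sum (\<lambda>k. if k = 0 then 0 else F_poly k * mconst (xi k)) {..<n})"
proof -
  have S: "S_series = bwyz.egf (\<lambda>k. if k = 0 then 0 else F_poly k * mconst (xi k))"
    by (simp add: S_series_def bwyz.egf_def fps_eq_iff mconst_mult mult_ac)
  show ?thesis unfolding exp_series_def S by (rule bwyz.exp_egf) simp
qed

text \<open>The \<xi> are coefficients and leave the functional; Wick's formula then adds a matching
  to each partition, and such pairs are the structures.\<close>

lemma bw_partition_sum:
  assumes fin: "finite U"
  shows "bw (partition_sum (\<lambda>k. if k = 0 then 0 else F_poly k * mconst (xi k)) U) = total_weight U"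
proof -
  have "bw (\<Prod>B\<in>P. if card B = 0 then 0 else F_poly (card B) * mconst (xi (card B))) =
      (\<Sum>M\<in>matchings U. weight (P, M))" if P: "partition_on U P" for P
  proof -
    \<comment> \<open>Blocks are nonempty, so the artificial value at 0 never enters.\<close>
    have "card B \<noteq> 0" if "B \<in> P" for B
      using partition_onD3[OF P] block_subset[OF P that] fin that by (metis card_0_eq finite_subset)
    then have "(if card B = 0 then 0 else F_poly (card B) * mconst (xi (card B))) =
        F_poly (card B) * mconst (xi (card B))" if "B \<in> P" for B
      using that by (simp only: if_False)
    then have "(\<Prod>B\<in>P. if card B = 0 then 0 else F_poly (card B) * mconst (xi (card B))) =
        (\<Prod>B\<in>P. F_poly (card B) * mconst (xi (card B)))"
      by (rule prod.cong[OF refl])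
    also have "\<dots> = mconst (\<Prod>B\<in>P. xi (card B)) * (\<Prod>B\<in>P. F_poly (card B))"
      by (simp add: prod.distrib mconst_prod mult.commute)
    finally have eq: "(\<Prod>B\<in>P. if card B = 0 then 0 else F_poly (card B) * mconst (xi (card B))) =
        mconst (\<Prod>B\<in>P. xi (card B)) * (\<Prod>B\<in>P. F_poly (card B))" .
    show ?thesis
      unfolding eq bw_mconst_mult bw_prod_F_poly[OF fin P] weight_def sum_distrib_left fst_conv
      by (rule sum.cong[OF refl mult.commute])
  qed
  then show ?thesis
    by (simp add: partition_sum_def bw_sum total_weight_def structures_def sum.cartesian_product)
qed

lemma fps_map_bw_exp_series:
  "fps_map bw (exp_series S_series) = coeff.egf (\<lambda>n. total_weight {..<n})"
proof (rule fps_ext)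
  fix n
  have "bw (P * mconst a) = bw P * a" for P a
    by (simp add: bw_mconst_mult mult.commute[of P] mult.commute[of a])
  then show "fps_map bw (exp_series S_series) $ n = coeff.egf (\<lambda>n. total_weight {..<n}) $ n"
    by (simp add: fps_map_def exp_series_S_series bwyz.egf_def coeff.egf_def bw_partition_sum)
qed

lemma graph_series_graph_classes:
  "graph_series graph_classes = coeff.egf (\<lambda>n. total_weight {..<n})"
proof (rule fps_ext)
  fix m
  show "graph_series graph_classes $ m = coeff.egf (\<lambda>n. total_weight {..<n}) $ m"
    using graph_series_nth[of "\<lambda>_. True" "\<lambda>_. True" m]
    by (simp add: graph_classes_def[abs_def] coeff.egf_def total_weight_def)
qed

lemma graph_series_connected_graph_classes:
  "graph_series connected_graph_classes = coeff.egf (\<lambda>n. connected_weight {..<n})"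
proof (rule fps_ext)
  fix m
  have "connected_mgraph H \<longleftrightarrow> connected_mgraph K"
    if "is_mgraph H" "is_iso \<phi> \<psi> H K" for H :: "(nat set, nat) mgraph" and K :: ngraph and \<phi> \<psi>
    using connected_mgraph_iso[OF that] connected_mgraph_iso[OF is_mgraph_iso[OF that] is_iso_inv[OF that]]
    by blast
  from graph_series_nth[of connected_mgraph connected_mgraph, OF this]
  show "graph_series connected_graph_classes $ m = coeff.egf (\<lambda>n. connected_weight {..<n}) $ m"
    by (simp add: connected_graph_classes_def[abs_def] coeff.egf_def connected_weight_def)
qed

text \<open>The empty structure has one coloring, with no even-white vertex; this is the constant
  term 1 that the logarithm requires.\<close>

lemma total_weight_empty: "total_weight ({} :: 'h set) = 1"
proof -
  have s: "structures ({} :: 'h set) = {({}, {})}"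
    by (simp add: structures_def matchings_empty partition_on_empty)
  then show ?thesis
    using W_poly_part_graph[of "({}, {})" "{} :: 'h set" t_ind]
    by (simp add: total_weight_def weight_def)
qed

text \<open>The empty graph does not count as connected, which fixes the constant term of the
  logarithm.\<close>

lemma connected_weight_empty: "connected_weight {} = 0"
  by (simp add: connected_weight_def connected_part_graph_iff cong: conj_cong)

theorem theorem3p10:
  shows "fps_map bw (exp_series S_series) = graph_series graph_classes \<and>
         graph_series connected_graph_classes = log_series (fps_map bw (exp_series S_series))"
proof
  show "fps_map bw (exp_series S_series) = graph_series graph_classes"
    by (simp add: fps_map_bw_exp_series graph_series_graph_classes)
  \<comment> \<open>The coefficients of this equation are \<open>total_weight_split\<close>, read on
    initial segments.\<close>
  have "fps_deriv (coeff.egf (\<lambda>n. total_weight {..<n})) =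
      fps_deriv (coeff.egf (\<lambda>n. connected_weight {..<n})) * coeff.egf (\<lambda>n. total_weight {..<n})"
    by (rule coeff.egf_deriv_eq)
      (rule split_recurrence[OF total_weight_split], (blast intro: weight_card_cong)+)
  then show "graph_series connected_graph_classes = log_series (fps_map bw (exp_series S_series))"
    unfolding fps_map_bw_exp_series graph_series_connected_graph_classes log_series_def
    by (intro coeff.fps_ln_compose_unique[symmetric])
      (simp_all add: coeff.egf_def total_weight_empty connected_weight_empty mconst_one)
qed

end
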